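(* Let $A=\bigoplus_{k\in\mathbb{Z}}A^k$ be a $\mathbb{Z}$-graded $A_\infty$-algebra over a field $\mathbb{K}$, $h=h_2+h_4+\cdots\in A$ a twisting element of positive degree, $m\ge1$, $p\in\mathbb{Z}$ and $x_p\in A^p$. Then (i) $x_p\in Z^{p\bar0}_{2m+1}$ if and only if there exists $x=x_p+x_{p+2}+\cdots+x_{p+2m-2}$, where $x_{p+2i}\in A^{p+2i}$ ($0\le i<m$), such that $\partial_{\mathbf{h}^{(m)}}\mathbf{x}^{(m)}_p=\mathbf{0}$, or equivalently, $\begin{pmatrix}\mathbf{h}^{(m)}&\mathbf{x}^{(m)}_p\\0&0\end{pmatrix}\in\mathrm{Mat}^{(m+1)}_+(A)$ is a twisting element. In this case, if $m\ge2$, $0\in\langle\underbrace{[h_2],\dots,[h_2]}_{m-1},[x_p]\rangle$. (ii) $x_p\in B^{p\bar0}_{2m+1}$ if and only if there exists $y=y_{p-2m+1}+y_{p-2m+3}+\cdots+y_{p-1}$, where $y_{p-2i+1}\in A^{p-2i+1}$ ($1\le i\le m$), such that $\partial_{\mathbf{h}^{(m)}}\mathbf{y}^{(m)}_{p-2m+1}=\begin{pmatrix}x_p\\\mathbf{0}\end{pmatrix}$ (the remaining $m-1$ entries being zero), or equivalently, $\begin{pmatrix}\mathbf{h}^{(m)}&\mathbf{y}^{(m)}_{p-2m+1}\\0&0\end{pmatrix}\in\mathrm{Mat}^{(m+1)}_+(A)$ is a defining system (of $\underbrace{[h_2],\dots,[h_2]}_{m-1},[y_{p-2m+1}]$ if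 $m\ge2$) and $x_p=\mu\begin{pmatrix}\mathbf{h}^{(m)}&\mathbf{y}^{(m)}_{p-2m+1}\\0&0\end{pmatrix}$. In this case, if $m\ge2$, $[x_p]\in\langle\underbrace{[h_2],\dots,[h_2]}_{m-1},[y_{p-2m+1}]\rangle$. (iii) Suppose $x_p\in Z^{p\bar0}_{2m+1}$ represents a class $[x_p]_{2m+1}\in E^{p\bar0}_{2m+1}$. Let $x$ be given by (i) and let $\tilde x=x+x_{p+2m}$ with any choice of $x_{p+2m}\in A^{p+2m}$. Then $\partial_{\mathbf{h}^{(m+1)}}\tilde{\mathbf{x}}^{(m+1)}_p=\begin{pmatrix}z_{p+2m+1}\\\mathbf{0}\end{pmatrix}$ (the remaining $m$ entries being zero) for some $z_{p+2m+1}\in A^{p+2m+1}$, or equivalently, $\begin{pmatrix}\mathbf{h}^{(m+1)}&\tilde{\mathbf{x}}^{(m+1)}_p\\0&0\end{pmatrix}\in\mathrm{Mat}^{(m+2)}_+(A)$ is a defining system (of $\underbrace{[h_2],\dots,[h_2]}_m,[x_p]$). Furthermore, $z_{p+2m+1}=\mu\begin{pmatrix}\mathbf{h}^{(m+1)}&\tilde{\mathbf{x}}^{(m+1)}_p\\0&0\end{pmatrix}\in A^{p+2m+1}$ descends to a class in $E^{p+2m+1,\bar0}_{2m+1}$ which is equal to $d_{2m+1}[x_p]_{2m+1}$.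
   Context: $A_\infty$-algebra: a graded $\mathbb{K}$-vector space $A$ with graded multilinear maps $b_n\colon A^{\otimes n}\to A$ ($n\ge1$) of degree $1$ such that for each $n\ge1$, $\sum_{r,t\ge0,\,s\ge1,\,r+s+t=n}b_{r+1+t}\circ(1^{\otimes r}\otimes b_s\otimes1^{\otimes t})=0$ (Koszul sign rule $(f\otimes g)(x\otimes y)=(-1)^{|g||x|}f(x)\otimes g(y)$). $\mathrm{H}(A)$ is the cohomology of $(A,b_1)$. $A^{\bar k}$ is the sum of the $A^n$ with $n\equiv k$ mod $2$. For $h\in A$, $\partial_ha=\sum_{n\ge0}b_{n+1}(\underbrace{h,\dots,h}_n,a)$; a twisting element of positive degree is $h=\sum_{i\ge1}h_{2i}$, $h_{2i}\in A^{2i}$, with $\partial_hh=0$; then $d:=\partial_h$ satisfies $d^2=0$. The infinite sums are assumed meaningful: for every finite subset $S\subset A$, $b_n$ vanishes on $S^n$ for all but finitely many $n$. Spectral sequence: $\mathrm{F}^pA=\bigoplus_{n\ge p}A^n$, $\mathrm{F}^pA^{\bar k}=\mathrm{F}^pA\cap A^{\bar k}$. For $r\ge0$, $Z^{p\bar0}_r=\{x\in A^p:\exists\,\tilde x\in\mathrm{F}^pA^{\bar p},\ \tilde x-x\in\mathrm{F}^{p+1}A,\ d\tilde x\in\mathrm{F}^{p+r}A\}$, $B^{p\bar0}_r=\{x\in A^p:\exists\,\tilde y\in\mathrm{F}^{p-r+1}A^{\overline{p-1}},\ d\tilde y\in\mathrm{F}^pA,\ d\tilde y-x\in\mathrm{F}^{p+1}A\}$,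 $E^{p\bar0}_r=Z^{p\bar0}_r/B^{p\bar0}_r$; for $r$ odd, $d_r\colon E^{p\bar0}_r\to E^{p+r,\bar0}_r$ sends the class of $x$ to the class of the $A^{p+r}$-component of $d\tilde x$, for any $\tilde x$ as in the definition of $Z^{p\bar0}_r$. Matrices: $(\mathbf{a}\odot\mathbf{b})_{ij}=\sum_ka_{ik}\otimes b_{kj}$ for square matrices, and similarly for a matrix times a column vector (no signs); $b_n$ acts component-wise. $\mathrm{Mat}^{(n)}_+(A)$ is the space of strictly upper-triangular $n\times n$ matrices. For $\mathbf{a}\in\mathrm{Mat}^{(n)}_+(A)$ and $\mathbf{c}$ a matrix or a column vector of the appropriate size, $\partial_{\mathbf{a}}\mathbf{c}=\sum_{k\ge0}b_{k+1}(\underbrace{\mathbf{a}\odot\cdots\odot\mathbf{a}}_k\odot\mathbf{c})$ (a finite sum). A matrix $\mathbf{a}\in\mathrm{Mat}^{(n)}_+(A)$ is called here a twisting element if $\partial_{\mathbf{a}}\mathbf{a}=0$ (no parity condition is imposed on its entries). $\mathbf{h}^{(m)}=(h_{ij})_{0\le i,j\le m-1}\in\mathrm{Mat}^{(m)}_+(A)$ has $h_{ij}=h_{2(j-i)}$ for $i<j$ and $0$ otherwise. For $x=x_p+x_{p+2}+\cdots$ with $x_{p+2i}\in A^{p+2i}$, $\mathbf{x}^{(m)}_p\in A^{\oplus m}$ is the column vector with entries, from top to bottom, $x_{p+2m-2},x_{p+2m-4},\dots,x_{p+2},x_p$ (similarly $\mathbf{y}^{(m)}_{p-2m+1}$, with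 entries from top to bottom $y_{p-1},\dots,y_{p-2m+1}$, and $\tilde{\mathbf{x}}^{(m+1)}_p$, with entries $x_{p+2m},\dots,x_p$). Massey products: index the entries of $\mathbf{a}\in\mathrm{Mat}^{(n+1)}_+(A)$ by $0\le i,j\le n$. $\mathbf{a}$ is a defining system if $(\partial_{\mathbf{a}}\mathbf{a})_{ij}=0$ for all $(i,j)\ne(0,n)$; put $\mu(\mathbf{a})=(\partial_{\mathbf{a}}\mathbf{a})_{0n}$. For $n\ge2$ it is a defining system of $\alpha_1,\dots,\alpha_n\in\mathrm{H}(A)$ if each $\alpha_i$ is represented by the (then closed) element $a_{i-1,i}$; in that case $\mu(\mathbf{a})$ is $b_1$-closed, and $\langle\alpha_1,\dots,\alpha_n\rangle\subset\mathrm{H}(A)$ is the set of all $[\mu(\mathbf{a})]$ over defining systems of $\alpha_1,\dots,\alpha_n$. *)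

theory Defs
  imports
    "HOL-Library.Groups_Big_Fun"
    "HOL-Library.Set_Algebras"
    "Jordan_Normal_Form.Matrix"
begin

section \<open>Graded vector spaces and A-infinity algebras\<close>

text \<open>The graded vector space is the whole type \<open>'a\<close>, as the internal direct sum of the
  subspaces \<open>A k\<close>.\<close>

locale graded_space = vector_space scale
  for scale :: "'k::field \<Rightarrow> 'a::ab_group_add \<Rightarrow> 'a" +
  fixes A :: "int \<Rightarrow> 'a set"
  assumes subspace_degree: "subspace (A k)"
    and direct_sum: "\<exists>!c. (\<forall>k. c k \<in> A k) \<and> finite {k. c k \<noteq> 0} \<and> x = Sum_any c"

definition component :: "(int \<Rightarrow> 'a::ab_group_add set) \<Rightarrow> int \<Rightarrow> 'a \<Rightarrow> 'a" where
  "component A k x = (THE c. (\<forall>k. c k \<in> A k) \<and> finite {k. c k \<noteq> 0} \<and> x = Sum_any c) k"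

definition degree_sum :: "(int \<Rightarrow> 'a::ab_group_add set) \<Rightarrow> int set \<Rightarrow> 'a set" where
  "degree_sum A I = {\<Sum>k\<in>S. c k | S c. finite S \<and> S \<subseteq> I \<and> (\<forall>k\<in>S. c k \<in> A k)}"

text \<open>All operations \<open>b\<^sub>n\<close>, \<open>n \<ge> 1\<close>, are packed into one function on lists: \<open>b [x\<^sub>1, \<dots>, x\<^sub>n]\<close> is
  \<open>b\<^sub>n(x\<^sub>1, \<dots>, x\<^sub>n)\<close>, and \<open>b []\<close> is irrelevant. In the relations (stated on homogeneous elements),
  \<open>xs\<close> splits into blocks of lengths \<open>r\<close>, \<open>s\<close>, \<open>t\<close>; as \<open>b\<^sub>s\<close> has degree 1, moving it past the first
  block gives the Koszul sign of the total degree of that block.\<close>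

locale A_infinity_algebra = graded_space scale A
  for scale :: "'k::field \<Rightarrow> 'a::ab_group_add \<Rightarrow> 'a" and A :: "int \<Rightarrow> 'a set" +
  fixes b :: "'a list \<Rightarrow> 'a"
  assumes multilinear: "Vector_Spaces.linear scale scale (\<lambda>x. b (us @ x # vs))"
    and degree_one:
      "xs \<noteq> [] \<Longrightarrow> list_all2 (\<lambda>k x. x \<in> A k) ks xs \<Longrightarrow> b xs \<in> A (sum_list ks + 1)"
    and A_infinity_relation:
      "xs \<noteq> [] \<Longrightarrow> list_all2 (\<lambda>k x. x \<in> A k) ks xs \<Longrightarrow>
        (\<Sum>(r, s, t)\<in>{(r, s, t). 1 \<le> s \<and> r + s + t = length xs}.
          let v = b (take r xs @ b (take s (drop r xs)) # drop (r + s) xs)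
          in if even (sum_list (take r ks)) then v else - v) = 0"

definition locally_finite_ops :: "('a::ab_group_add list \<Rightarrow> 'a) \<Rightarrow> bool" where
  "locally_finite_ops b \<longleftrightarrow>
    (\<forall>S. finite S \<longrightarrow> finite {n. \<exists>xs. length xs = n \<and> set xs \<subseteq> S \<and> b xs \<noteq> 0})"

definition cohomology_class :: "('a::ab_group_add list \<Rightarrow> 'a) \<Rightarrow> 'a \<Rightarrow> 'a set" where
  "cohomology_class b x = x +o range (\<lambda>y. b [y])"

definition cohomology :: "('a::ab_group_add list \<Rightarrow> 'a) \<Rightarrow> 'a set set" where
  "cohomology b = cohomology_class b ` {x. b [x] = 0}"


section \<open>Twisting elements of positive degree and the spectral sequence\<close>

definition twisted_diff :: "('a::ab_group_add list \<Rightarrow> 'a) \<Rightarrow> 'a \<Rightarrow> 'a \<Rightarrow> 'a" where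
  "twisted_diff b h a = Sum_any (\<lambda>n. b (replicate n h @ [a]))"

definition positive_twisting_element ::
    "(int \<Rightarrow> 'a::ab_group_add set) \<Rightarrow> ('a list \<Rightarrow> 'a) \<Rightarrow> 'a \<Rightarrow> bool" where
  "positive_twisting_element A b h \<longleftrightarrow>
    h \<in> degree_sum A {k. 0 < k \<and> even k} \<and> twisted_diff b h h = 0"

definition filt :: "(int \<Rightarrow> 'a::ab_group_add set) \<Rightarrow> int \<Rightarrow> 'a set" where
  "filt A p = degree_sum A {p..}"

definition parity_part :: "(int \<Rightarrow> 'a::ab_group_add set) \<Rightarrow> int \<Rightarrow> 'a set" where
  "parity_part A k = degree_sum A {n. n mod 2 = k mod 2}"

definition ss_lift :: "(int \<Rightarrow> 'a::ab_group_add set) \<Rightarrow> ('a list \<Rightarrow> 'a) \<Rightarrow> 'a \<Rightarrow>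
    nat \<Rightarrow> int \<Rightarrow> 'a \<Rightarrow> 'a \<Rightarrow> bool" where
  "ss_lift A b h r p x xt \<longleftrightarrow>
    xt \<in> filt A p \<inter> parity_part A p \<and> xt - x \<in> filt A (p + 1) \<and>
    twisted_diff b h xt \<in> filt A (p + int r)"

definition ss_Z :: "(int \<Rightarrow> 'a::ab_group_add set) \<Rightarrow> ('a list \<Rightarrow> 'a) \<Rightarrow> 'a \<Rightarrow>
    nat \<Rightarrow> int \<Rightarrow> 'a set" where
  "ss_Z A b h r p = {x \<in> A p. \<exists>xt. ss_lift A b h r p x xt}"

definition ss_B :: "(int \<Rightarrow> 'a::ab_group_add set) \<Rightarrow> ('a list \<Rightarrow> 'a) \<Rightarrow> 'a \<Rightarrow>
    nat \<Rightarrow> int \<Rightarrow> 'a set" where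
  "ss_B A b h r p = {x \<in> A p. \<exists>yt \<in> filt A (p - int r + 1) \<inter> parity_part A (p - 1).
    twisted_diff b h yt \<in> filt A p \<and> twisted_diff b h yt - x \<in> filt A (p + 1)}"

definition ss_class :: "(int \<Rightarrow> 'a::ab_group_add set) \<Rightarrow> ('a list \<Rightarrow> 'a) \<Rightarrow> 'a \<Rightarrow>
    nat \<Rightarrow> int \<Rightarrow> 'a \<Rightarrow> 'a set" where
  "ss_class A b h r p x = x +o ss_B A b h r p"

definition ss_E :: "(int \<Rightarrow> 'a::ab_group_add set) \<Rightarrow> ('a list \<Rightarrow> 'a) \<Rightarrow> 'a \<Rightarrow>
    nat \<Rightarrow> int \<Rightarrow> 'a set set" where
  "ss_E A b h r p = ss_class A b h r p ` ss_Z A b h r p"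

text \<open>The differential \<open>d\<^sub>r\<close> on \<open>ss_E A b h r p\<close>, meaningful for odd \<open>r\<close> only. The description
  determines a value only if all representatives \<open>x\<close> and all lifts \<open>xt\<close> give the same class.\<close>

definition ss_d :: "(int \<Rightarrow> 'a::ab_group_add set) \<Rightarrow> ('a list \<Rightarrow> 'a) \<Rightarrow> 'a \<Rightarrow>
    nat \<Rightarrow> int \<Rightarrow> 'a set \<Rightarrow> 'a set" where
  "ss_d A b h r p C = (THE D. \<exists>x\<in>ss_Z A b h r p. \<exists>xt.
    C = ss_class A b h r p x \<and> ss_lift A b h r p x xt \<and>
    D = ss_class A b h r (p + int r) (component A (p + int r) (twisted_diff b h xt)))"


section \<open>Twisting by strictly upper-triangular matrices\<close>

definition Mat_plus :: "nat \<Rightarrow> 'a::zero mat set" where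
  "Mat_plus n = {a \<in> carrier_mat n n. \<forall>i<n. \<forall>j\<le>i. a $$ (i, j) = 0}"

text \<open>Expanding the products, the \<open>i\<close>-th entry of \<open>a \<odot> \<dots> \<odot> a \<odot> c\<close> (with \<open>k\<close> factors \<open>a\<close>) is the sum
  over all \<open>j\<^sub>1, \<dots>, j\<^sub>k\<close> of \<open>a\<^bsub>i j\<^sub>1\<^esub> \<otimes> a\<^bsub>j\<^sub>1 j\<^sub>2\<^esub> \<otimes> \<dots> \<otimes> a\<^bsub>j\<^sub>k\<^sub>-\<^sub>1 j\<^sub>k\<^esub> \<otimes> c\<^bsub>j\<^sub>k\<^esub>\<close>;
  \<open>path_word\<close> lists the tensor factors of one summand.\<close>

primrec path_word :: "'a mat \<Rightarrow> 'a vec \<Rightarrow> nat \<Rightarrow> nat list \<Rightarrow> 'a list" where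
  "path_word a c i [] = [c $ i]"
| "path_word a c i (j # js) = a $$ (i, j) # path_word a c j js"

definition twisted_vec :: "('a::ab_group_add list \<Rightarrow> 'a) \<Rightarrow> 'a mat \<Rightarrow> 'a vec \<Rightarrow> 'a vec" where
  "twisted_vec b a c = vec (dim_row a) (\<lambda>i. Sum_any (\<lambda>k.
    \<Sum>js | length js = k \<and> set js \<subseteq> {..<dim_row a}. b (path_word a c i js)))"

definition twisted_mat :: "('a::ab_group_add list \<Rightarrow> 'a) \<Rightarrow> 'a mat \<Rightarrow> 'a mat \<Rightarrow> 'a mat" where
  "twisted_mat b a c =
    mat (dim_row a) (dim_col c) (\<lambda>(i, j). twisted_vec b a (col c j) $ i)"

definition twisting_matrix :: "('a::ab_group_add list \<Rightarrow> 'a) \<Rightarrow> nat \<Rightarrow> 'a mat \<Rightarrow> bool" where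
  "twisting_matrix b n a \<longleftrightarrow> a \<in> Mat_plus n \<and> twisted_mat b a a = 0\<^sub>m n n"

definition defining_system :: "('a::ab_group_add list \<Rightarrow> 'a) \<Rightarrow> nat \<Rightarrow> 'a mat \<Rightarrow> bool" where
  "defining_system b n a \<longleftrightarrow> a \<in> Mat_plus (n + 1) \<and>
    (\<forall>i\<le>n. \<forall>j\<le>n. (i, j) \<noteq> (0, n) \<longrightarrow> twisted_mat b a a $$ (i, j) = 0)"

definition massey_value :: "('a::ab_group_add list \<Rightarrow> 'a) \<Rightarrow> nat \<Rightarrow> 'a mat \<Rightarrow> 'a" where
  "massey_value b n a = twisted_mat b a a $$ (0, n)"

text \<open>The list index is shifted: \<open>\<alpha>s ! i\<close> is \<open>\<alpha>\<^sub>i\<^sub>+\<^sub>1\<close>.\<close>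

definition defining_system_of ::
    "('a::ab_group_add list \<Rightarrow> 'a) \<Rightarrow> 'a set list \<Rightarrow> 'a mat \<Rightarrow> bool" where
  "defining_system_of b \<alpha>s a \<longleftrightarrow> 2 \<le> length \<alpha>s \<and> set \<alpha>s \<subseteq> cohomology b \<and>
    defining_system b (length \<alpha>s) a \<and>
    (\<forall>i<length \<alpha>s. \<alpha>s ! i = cohomology_class b (a $$ (i, i + 1)))"

definition massey_product ::
    "('a::ab_group_add list \<Rightarrow> 'a) \<Rightarrow> 'a set list \<Rightarrow> 'a set set" where
  "massey_product b \<alpha>s =
    {cohomology_class b (massey_value b (length \<alpha>s) a) | a. defining_system_of b \<alpha>s a}"

definition twisting_toeplitz :: "(int \<Rightarrow> 'a::ab_group_add set) \<Rightarrow> nat \<Rightarrow> 'a \<Rightarrow> 'a mat" where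
  "twisting_toeplitz A m h =
    mat m m (\<lambda>(i, j). if i < j then component A (2 * (int j - int i)) h else 0)"

text \<open>The column with entries \<open>x\<^bsub>p+2m-2\<^esub>, \<dots>, x\<^bsub>p+2\<^esub>, x\<^sub>p\<close> from top to bottom.\<close>

definition component_vec ::
    "(int \<Rightarrow> 'a::ab_group_add set) \<Rightarrow> nat \<Rightarrow> int \<Rightarrow> 'a \<Rightarrow> 'a vec" where
  "component_vec A m p x = vec m (\<lambda>i. component A (p + 2 * (int m - 1 - int i)) x)"

definition bordered_mat :: "'a::zero mat \<Rightarrow> 'a vec \<Rightarrow> 'a mat" where
  "bordered_mat a v =
    four_block_mat a (mat_of_cols (dim_vec v) [v]) (0\<^sub>m 1 (dim_col a)) (0\<^sub>m 1 1)"

end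

theory Submission
  imports Defs
begin

text \<open>The theorem says the same thing twice: once about the lowest homogeneous components of
  \<open>\<partial>\<^sub>h a\<close>, once about the rows of a matrix equation. Let \<open>a\<close> have components only in degrees at least
  \<open>q\<close>, and put the components \<open>a\<^bsub>q+2m-2\<^esub>, \<dots>, a\<^sub>q\<close> into a column. Expanding
  \<open>\<partial>\<^sub>h a = \<Sum>\<^sub>n b\<^bsub>n+1\<^esub>(h, \<dots>, h, a)\<close> multilinearly, the component of degree \<open>q + 2l + 1\<close> is the sum of
  all \<open>b(h\<^bsub>2d\<^sub>1\<^esub>, \<dots>, h\<^bsub>2d\<^sub>n\<^esub>, a\<^bsub>q+2e\<^esub>)\<close> with \<open>d\<^sub>1 + \<dots> + d\<^sub>n + e = l\<close> and all \<open>d\<^sub>i\<close> positive.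
  Since \<open>h\<close> enters the Toeplitz matrix at position \<open>(i, j)\<close> through \<open>h\<^bsub>2(j-i)\<^esub>\<close>, these summands are
  indexed by the increasing paths from the row \<open>m - 1 - l\<close>, and the sum is the entry of the matrix
  product in that row. This is \<open>twisted_vec_toeplitz\<close>; everything else is read off from it.

  The columns of the Toeplitz matrix are themselves columns of components of \<open>h\<close>, so
  \<open>\<partial>\<^sub>h h = 0\<close> makes all entries of \<open>\<partial>\<^bsub>\<^bold>a\<^esub> \<^bold>a\<close> for a bordered Toeplitz matrix \<open>\<^bold>a\<close> vanish, except in the last
  column, which is the matrix equation (\<open>twisted_mat_bordered\<close>). Hence the equivalences with
  twisting matrices and defining systems, and the statements on Massey products.

  A lift in the sense of the spectral sequence may be truncated to its lowest \<open>m\<close> components of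
  the right parity without changing the column. Parity kills every second component of
  \<open>\<partial>\<^sub>h a\<close>, so the vanishing of all rows, or of all rows but the top one, is exactly membership in the
  filtration step that defines cycles, or boundaries (\<open>bottom_rows_vanish_iff\<close>).

  The spectral sequence differential is defined by a choice of representative and lift. Its
  independence of this choice, and the fact that its values are cycles, need \<open>\<partial>\<^sub>h \<partial>\<^sub>h = 0\<close>
  (\<open>twisted_diff_square_zero\<close>), which is obtained by summing the \<open>A\<^sub>\<infinity>\<close>-relations for the words
  \<open>h, \<dots>, h, a\<close>; no signs occur because \<open>h\<close> has even degrees.\<close>


section \<open>Homogeneous components\<close>

lemma Sum_any_additive:
  fixes f :: "'a::ab_group_add \<Rightarrow> 'c::ab_group_add" and c :: "'b \<Rightarrow> 'a"
  assumes add: "\<And>x y. f (x + y) = f x + f y" and fin: "finite {k. c k \<noteq> 0}"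
  shows "f (Sum_any c) = Sum_any (\<lambda>k. f (c k))"
proof -
  have f0: "f 0 = 0" using add[of 0 0] by simp
  have fsum: "f (sum c S) = (\<Sum>k\<in>S. f (c k))" for S
    by (induction S rule: infinite_finite_induct) (auto simp: f0 add)
  have "Sum_any (\<lambda>k. f (c k)) = (\<Sum>k\<in>{k. c k \<noteq> 0}. f (c k))"
    by (rule Sum_any.expand_superset[OF fin]) (auto simp: f0)
  then show ?thesis by (simp add: Sum_any.expand_set fsum)
qed

lemma in_set_list_all2_replicate:
  "list_all2 (\<in>) ks (replicate n I) \<Longrightarrow> k \<in> set ks \<Longrightarrow> k \<in> I"
  by (auto simp: in_set_conv_nth list_all2_conv_all_nth)

context graded_space
begin

lemma zero_degree: "0 \<in> A k"
  and add_degree: "x \<in> A k \<Longrightarrow> y \<in> A k \<Longrightarrow> x + y \<in> A k"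
  and uminus_degree: "x \<in> A k \<Longrightarrow> - x \<in> A k"
  using subspace_0[OF subspace_degree] subspace_add[OF subspace_degree]
    subspace_neg[OF subspace_degree] by blast+

lemma component_decomposition:
  "(\<forall>k. component A k x \<in> A k) \<and> finite {k. component A k x \<noteq> 0}
    \<and> x = Sum_any (\<lambda>k. component A k x)"
proof -
  let ?P = "\<lambda>c. (\<forall>k. c k \<in> A k) \<and> finite {k. c k \<noteq> 0} \<and> x = Sum_any c"
  have "?P c" if "c = The ?P" for c
    unfolding that by (rule theI'[OF direct_sum])
  moreover have "(\<lambda>k. component A k x) = The ?P"
    by (rule ext) (simp only: component_def)
  ultimately show ?thesis .
qed

lemma component_in_degree: "component A k x \<in> A k"
  and finite_components: "finite {k. component A k x \<noteq> 0}"
  and Sum_any_components: "Sum_any (\<lambda>k. component A k x) = x"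
  using component_decomposition[of x] by auto

lemma component_unique:
  assumes "\<And>k. c k \<in> A k" "finite {k. c k \<noteq> 0}" "x = Sum_any c"
  shows "component A k x = c k"
proof -
  obtain c' where unique:
    "\<And>c. (\<forall>k. c k \<in> A k) \<and> finite {k. c k \<noteq> 0} \<and> x = Sum_any c \<Longrightarrow> c = c'"
    using direct_sum[of x] unfolding Ex1_def by blast
  have "(\<lambda>k. component A k x) = c'"
    by (rule unique) (rule component_decomposition)
  moreover have "c = c'"
    by (rule unique) (use assms in blast)
  ultimately have "(\<lambda>k. component A k x) = c" by simp
  then show ?thesis by (rule fun_cong)
qed

lemma component_homogeneous:
  assumes "x \<in> A j" shows "component A k x = (if k = j then x else 0)"
  by (rule component_unique) (use assms zero_degree in auto)

lemma component_add: "component A k (x + y) = component A k x + component A k y"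
proof (rule component_unique)
  let ?c = "\<lambda>k. component A k x + component A k y"
  show "finite {k. ?c k \<noteq> 0}"
    by (rule finite_subset[OF _ finite_UnI[OF finite_components[of x] finite_components[of y]]]) auto
  show "x + y = Sum_any ?c"
    by (simp add: Sum_any.distrib finite_components Sum_any_components)
qed (auto intro: add_degree component_in_degree)

lemma component_zero [simp]: "component A k 0 = 0"
  using component_homogeneous[OF zero_degree] by simp

lemma component_uminus: "component A k (- x) = - component A k x"
  using component_add[of k x "- x"] by (simp add: eq_neg_iff_add_eq_0 add.commute)

lemma component_diff: "component A k (x - y) = component A k x - component A k y"
  using component_add[of k x "- y"] by (simp add: component_uminus)

lemma component_sum: "component A k (sum f S) = (\<Sum>i\<in>S. component A k (f i))"
  by (induction S rule: infinite_finite_induct) (auto simp: component_add)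

lemma component_Sum_any:
  "finite {n. f n \<noteq> 0} \<Longrightarrow> component A k (Sum_any f) = Sum_any (\<lambda>n. component A k (f n))"
  by (rule Sum_any_additive[OF component_add])

lemma component_sum_homogeneous:
  assumes "finite S" "\<And>k. k \<in> S \<Longrightarrow> c k \<in> A k"
  shows "component A j (\<Sum>k\<in>S. c k) = (if j \<in> S then c j else 0)"
proof -
  have "component A j (\<Sum>k\<in>S. c k) = (\<Sum>k\<in>S. if k = j then c k else 0)"
    unfolding component_sum
    by (rule sum.cong) (auto simp: component_homogeneous[OF assms(2)])
  then show ?thesis using assms(1) by simp
qed

lemma in_degree_sum_iff: "x \<in> degree_sum A I \<longleftrightarrow> (\<forall>k. k \<notin> I \<longrightarrow> component A k x = 0)"
proof
  assume "x \<in> degree_sum A I"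
  then show "\<forall>k. k \<notin> I \<longrightarrow> component A k x = 0"
    unfolding degree_sum_def by (auto simp: component_sum_homogeneous)
next
  assume *: "\<forall>k. k \<notin> I \<longrightarrow> component A k x = 0"
  have "x = (\<Sum>k\<in>{k. component A k x \<noteq> 0}. component A k x)"
    using Sum_any_components[of x] by (simp add: Sum_any.expand_set)
  then show "x \<in> degree_sum A I"
    unfolding degree_sum_def using * finite_components[of x] component_in_degree by blast
qed

lemma in_filt_iff: "x \<in> filt A p \<longleftrightarrow> (\<forall>k<p. component A k x = 0)"
  by (auto simp: filt_def in_degree_sum_iff not_le)

lemma in_parity_part_iff:
  "x \<in> parity_part A p \<longleftrightarrow> (\<forall>k. k mod 2 \<noteq> p mod 2 \<longrightarrow> component A k x = 0)"
  by (auto simp: parity_part_def in_degree_sum_iff)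

lemma degree_sum_zero: "0 \<in> degree_sum A I"
  and degree_sum_add: "x \<in> degree_sum A I \<Longrightarrow> y \<in> degree_sum A I \<Longrightarrow> x + y \<in> degree_sum A I"
  and degree_sum_mono: "x \<in> degree_sum A I \<Longrightarrow> I \<subseteq> J \<Longrightarrow> x \<in> degree_sum A J"
  by (auto simp: in_degree_sum_iff component_add component_uminus)

lemma degree_sum_UNIV: "x \<in> degree_sum A UNIV"
  by (simp add: in_degree_sum_iff)

lemma degree_sum_singleton: "x \<in> A k \<Longrightarrow> x \<in> degree_sum A {k}"
  by (simp add: in_degree_sum_iff component_homogeneous)

lemma singletons_in_degree_sums:
  "list_all2 (\<lambda>k x. x \<in> A k) ks xs \<Longrightarrow>
    list_all2 (\<lambda>I x. x \<in> degree_sum A I) (map (\<lambda>k. {k}) ks) xs"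
  by (auto simp: list_all2_map1 elim!: list_all2_mono intro: degree_sum_singleton)

lemma word_in_degree_sums:
  assumes "x \<in> degree_sum A I" "a \<in> degree_sum A J"
  shows "list_all2 (\<lambda>I x. x \<in> degree_sum A I) (replicate n I @ [J]) (replicate n x @ [a])"
  using assms by (induction n) auto

text \<open>The subspaces \<open>degree_sum A I\<close> are spanned by their homogeneous elements, so a multilinear
  expression is controlled by its values on homogeneous arguments. The target \<open>V\<close> is closed
  under addition: another \<open>degree_sum\<close> for a degree estimate, or the zero subgroup for an identity.\<close>

lemma multilinear_on_degree_sums:
  fixes F :: "'a list \<Rightarrow> 'b::ab_group_add"
  assumes add: "\<And>us x y vs. F (us @ (x + y) # vs) = F (us @ x # vs) + F (us @ y # vs)"
    and V: "0 \<in> V" "\<And>u v. u \<in> V \<Longrightarrow> v \<in> V \<Longrightarrow> u + v \<in> V"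
    and hom: "\<And>ks xs. list_all2 (\<lambda>k x. x \<in> A k) ks xs \<Longrightarrow> list_all2 (\<in>) ks Is \<Longrightarrow> F xs \<in> V"
    and xs: "list_all2 (\<lambda>I x. x \<in> degree_sum A I) Is xs"
  shows "F xs \<in> V"
proof -
  \<comment> \<open>The arguments are made homogeneous one at a time, from the left: \<open>us\<close> is the part already
    treated, \<open>vs\<close> the rest.\<close>
  have "F (us @ vs) \<in> V"
    if "list_all2 (\<lambda>k x. x \<in> A k) ks us" "list_all2 (\<in>) ks Js"
      "list_all2 (\<lambda>I x. x \<in> degree_sum A I) Ks vs" "Is = Js @ Ks" for us ks Js Ks vs
    using that
  proof (induction vs arbitrary: us ks Js Ks)
    case Nil
    then show ?case using hom by auto
  next
    case (Cons x vs)
    from Cons.prems(3) obtain I Ks' where Ks: "Ks = I # Ks'" and x: "x \<in> degree_sum A I"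
      and vs: "list_all2 (\<lambda>I x. x \<in> degree_sum A I) Ks' vs"
      by (auto simp: list_all2_Cons2)
    obtain S c where S: "finite S" "S \<subseteq> I" "\<forall>k\<in>S. c k \<in> A k" "x = (\<Sum>k\<in>S. c k)"
      using x unfolding degree_sum_def by auto
    have step: "F (us @ c k # vs) \<in> V" if "k \<in> S" for k
    proof -
      have "F ((us @ [c k]) @ vs) \<in> V"
      proof (rule Cons.IH)
        show "list_all2 (\<lambda>k x. x \<in> A k) (ks @ [k]) (us @ [c k])"
          using Cons.prems(1) S(3) that by (auto intro: list_all2_appendI)
        show "list_all2 (\<in>) (ks @ [k]) (Js @ [I])"
          using Cons.prems(2) S(2) that by (auto intro: list_all2_appendI)
      qed (use vs Cons.prems(4) Ks in auto)
      then show ?thesis by simp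
    qed
    have F0: "F (us @ 0 # vs) = 0" using add[of us 0 0 vs] by simp
    have "F (us @ (\<Sum>k\<in>T. c k) # vs) \<in> V" if "T \<subseteq> S" for T
      using finite_subset[OF that S(1)] that
      by (induction T rule: finite_induct) (auto simp: F0 add V step)
    then show ?case using S(4) by simp
  qed
  from this[of "[]" "[]" "[]" Is xs] xs show ?thesis by simp
qed

end


section \<open>Degrees of operations and the relations without signs\<close>

lemma even_sum_list: "(\<And>k. k \<in> set ks \<Longrightarrow> even k) \<Longrightarrow> even (sum_list ks)" for ks :: "int list"
  by (induction ks) auto

context A_infinity_algebra
begin

lemma b_add: "b (us @ (x + y) # vs) = b (us @ x # vs) + b (us @ y # vs)"
  and b_zero: "b (us @ 0 # vs) = 0"
  and b_sum: "b (us @ sum f S # vs) = (\<Sum>i\<in>S. b (us @ f i # vs))"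
proof -
  interpret module_hom scale scale "\<lambda>x. b (us @ x # vs)"
    using multilinear[of us vs] by (rule Vector_Spaces.linear.axioms(3))
  show "b (us @ (x + y) # vs) = b (us @ x # vs) + b (us @ y # vs)" by (rule add)
  show "b (us @ 0 # vs) = 0" by (rule zero)
  show "b (us @ sum f S # vs) = (\<Sum>i\<in>S. b (us @ f i # vs))" by (rule sum)
qed

lemma b_zero_in_list: "0 \<in> set xs \<Longrightarrow> b xs = 0"
  by (metis b_zero split_list)

lemma b_in_degree_sum:
  assumes xs: "list_all2 (\<lambda>I x. x \<in> degree_sum A I) Is xs" "Is \<noteq> []"
    and J: "\<And>ks. list_all2 (\<in>) ks Is \<Longrightarrow> sum_list ks + 1 \<in> J"
  shows "b xs \<in> degree_sum A J"
proof (rule multilinear_on_degree_sums[where F = b, OF b_add degree_sum_zero degree_sum_add _ xs(1)])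
  fix ks ys assume "list_all2 (\<lambda>k x. x \<in> A k) ks ys" and ks: "list_all2 (\<in>) ks Is"
  moreover have "ys \<noteq> []" using calculation xs(2) by (auto dest: list_all2_lengthD)
  ultimately have "b ys \<in> A (sum_list ks + 1)" by (intro degree_one)
  then show "b ys \<in> degree_sum A J"
    using J[OF ks] by (blast intro: degree_sum_mono degree_sum_singleton)
qed

text \<open>Fixing the degrees of all arguments but the last, the degree of the value determines that of
  the last argument.\<close>

lemma component_b_last:
  assumes us: "list_all2 (\<lambda>k x. x \<in> A k) ks us"
  shows "component A (sum_list ks + q + 1) (b (us @ [a])) = b (us @ [component A q a])"
proof -
  let ?a = "component A q a"
  have ks: "ks' = ks" if "list_all2 (\<in>) ks' (map (\<lambda>k. {k}) ks)" for ks'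
    using that by (simp add: list_all2_map2 list_all2_eq)
  have "b (us @ [a - ?a]) \<in> degree_sum A (- {sum_list ks + q + 1})"
  proof (rule b_in_degree_sum)
    show "list_all2 (\<lambda>I x. x \<in> degree_sum A I) (map (\<lambda>k. {k}) ks @ [- {q}]) (us @ [a - ?a])"
      using singletons_in_degree_sums[OF us] component_homogeneous[OF component_in_degree[of q a]]
      by (auto intro!: list_all2_appendI simp: in_degree_sum_iff component_diff)
  qed (auto simp: list_all2_append2 list_all2_Cons2 dest!: ks)
  then have "component A (sum_list ks + q + 1) (b (us @ [a - ?a])) = 0"
    by (simp add: in_degree_sum_iff)
  moreover have "b (us @ [?a]) \<in> A (sum_list ks + q + 1)"
    using degree_one[of "us @ [?a]" "ks @ [q]"] us component_in_degree[of q a]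
    by (auto intro: list_all2_appendI)
  moreover have "b (us @ [a]) = b (us @ [a - ?a]) + b (us @ [?a])"
    using b_add[of us "a - ?a" ?a "[]"] by simp
  ultimately show ?thesis by (simp add: component_add component_homogeneous)
qed

text \<open>The terms of the \<open>A\<^sub>\<infinity>\<close>-relation without their signs.\<close>

definition relation_term :: "nat \<Rightarrow> nat \<Rightarrow> 'a list \<Rightarrow> 'a" where
  "relation_term r s xs = b (take r xs @ b (take s (drop r xs)) # drop (r + s) xs)"

lemma relation_term_append:
  "relation_term (length us) (length vs) (us @ vs @ ws) = b (us @ b vs # ws)"
  by (simp add: relation_term_def)

lemma relation_term_add:
  assumes "1 \<le> s" "r + s + t = length (us @ x # vs)"
  shows "relation_term r s (us @ (x + y) # vs)
    = relation_term r s (us @ x # vs) + relation_term r s (us @ y # vs)"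
proof -
  \<comment> \<open>The slot lies in the left block, in the inner operation, or in the right block.\<close>
  consider "length us < r" | "r \<le> length us" "length us < r + s" | "r + s \<le> length us" by linarith
  then show ?thesis
  proof cases
    case 1
    then obtain d where r: "r = length us + Suc d" by (metis add_Suc_right less_imp_Suc_add)
    show ?thesis by (simp add: relation_term_def r b_add)
  next
    case 2
    then obtain u' u'' where us: "us = u' @ u''" "length u' = r"
      by (metis append_take_drop_id length_take min.absorb2)
    obtain d where s: "s = length u'' + Suc d"
      using 2 us by (metis add_less_cancel_left length_append less_imp_Suc_add add_Suc_right)
    show ?thesis using us(2)[symmetric] by (simp add: relation_term_def us(1) s b_add)
  next
    case 3
    then obtain d where us: "length us = r + s + d" by (metis le_Suc_ex)
    have inner: "take s (drop r (us @ z # vs)) = take s (drop r us)" for z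
      using us by simp
    have "relation_term r s (us @ z # vs)
        = b ((take r us @ b (take s (drop r us)) # drop (r + s) us) @ z # vs)" for z
      unfolding relation_term_def inner using us by simp
    then show ?thesis by (simp only: b_add)
  qed
qed

text \<open>All arguments but the last have even degree, and the inner operation contains at least one
  argument, so no block in front of it contributes a sign.\<close>

lemma A_infinity_relation_even:
  assumes xs: "list_all2 (\<lambda>I x. x \<in> degree_sum A I) (replicate n {k. even k} @ [UNIV]) xs"
  shows "(\<Sum>(r, s, t)\<in>{(r, s, t). 1 \<le> s \<and> r + s + t = Suc n}. relation_term r s xs) = 0"
proof -
  let ?T = "{(r, s, t). 1 \<le> s \<and> r + s + t = Suc n}"
  \<comment> \<open>Off the lists of length \<open>n + 1\<close> the expression is set to zero, which keeps it multilinear.\<close>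
  define F where "F xs = (if length xs = Suc n then (\<Sum>(r, s, t)\<in>?T. relation_term r s xs) else 0)"
    for xs
  have "F xs \<in> {0}"
  proof (rule multilinear_on_degree_sums[where F = F, OF _ _ _ _ xs])
    show "F (us @ (x + y) # vs) = F (us @ x # vs) + F (us @ y # vs)" for us x y vs
    proof (cases "length (us @ x # vs) = Suc n")
      case True
      have "(\<Sum>(r, s, t)\<in>?T. relation_term r s (us @ (x + y) # vs))
        = (\<Sum>(r, s, t)\<in>?T. relation_term r s (us @ x # vs) + relation_term r s (us @ y # vs))"
        by (rule sum.cong) (use True in \<open>auto intro!: relation_term_add\<close>)
      then show ?thesis using True by (simp add: F_def split_def sum.distrib)
    qed (simp add: F_def)
  next
    fix ks ys
    assume ys: "list_all2 (\<lambda>k x. x \<in> A k) ks ys"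
      and ks: "list_all2 (\<in>) ks (replicate n {k. even k} @ [UNIV])"
    have len: "length ys = Suc n" "length ks = Suc n"
      using ys ks by (auto dest!: list_all2_lengthD)
    have even: "even (sum_list (take r ks))" if "r \<le> n" for r
    proof -
      have "even k" if k: "k \<in> set (take r ks)" for k
      proof -
        obtain i where "i < r" "k = ks ! i" using k len(2) \<open>r \<le> n\<close>
          by (auto simp: in_set_conv_nth)
        then show ?thesis using list_all2_nthD[OF ks, of i] len(2) \<open>r \<le> n\<close>
          by (simp add: nth_append)
      qed
      then show ?thesis by (rule even_sum_list)
    qed
    have "(\<Sum>(r, s, t)\<in>?T. relation_term r s ys)
      = (\<Sum>(r, s, t)\<in>?T.
          let v = b (take r ys @ b (take s (drop r ys)) # drop (r + s) ys)
          in if even (sum_list (take r ks)) then v else - v)"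
      by (rule sum.cong) (auto simp: relation_term_def Let_def even)
    also have "\<dots> = 0"
    proof -
      have "ys \<noteq> []" using len(1) by auto
      from A_infinity_relation[OF this ys] show ?thesis by (simp only: len)
    qed
    finally show "F ys \<in> {0}" by (simp add: F_def)
  qed auto
  moreover have "length xs = Suc n" using list_all2_lengthD[OF xs] by simp
  ultimately show ?thesis by (simp add: F_def)
qed

end


section \<open>The twisted differential\<close>

locale twisted_A_infinity_algebra = A_infinity_algebra scale A b
  for scale :: "'k::field \<Rightarrow> 'a::ab_group_add \<Rightarrow> 'a" and A b +
  fixes h :: 'a
  assumes locally_finite: "locally_finite_ops b"
    and twisting: "positive_twisting_element A b h"
begin

lemma h_degrees: "h \<in> degree_sum A {k. 0 < k \<and> even k}"
  and twisted_diff_h: "twisted_diff b h h = 0"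
  using twisting by (auto simp: positive_twisting_element_def)

lemma long_words_vanish:
  assumes "finite S"
  obtains N where "\<And>xs. set xs \<subseteq> S \<Longrightarrow> N \<le> length xs \<Longrightarrow> b xs = 0"
proof -
  have "finite {n. \<exists>xs. length xs = n \<and> set xs \<subseteq> S \<and> b xs \<noteq> 0}"
    using locally_finite assms by (simp add: locally_finite_ops_def)
  then obtain N where N: "\<forall>n\<in>{n. \<exists>xs. length xs = n \<and> set xs \<subseteq> S \<and> b xs \<noteq> 0}. n < N"
    using finite_nat_set_iff_bounded by blast
  show thesis by (rule that[of N]) (use N in force)
qed

lemma finite_twisted_terms: "finite {n. b (replicate n h @ [a]) \<noteq> 0}"
proof -
  obtain N where N: "\<And>xs. set xs \<subseteq> {h, a} \<Longrightarrow> N \<le> length xs \<Longrightarrow> b xs = 0"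
    using long_words_vanish[of "{h, a}"] by auto
  have "b (replicate n h @ [a]) = 0" if "N \<le> n" for n
    by (rule N) (use that in auto)
  then have "{n. b (replicate n h @ [a]) \<noteq> 0} \<subseteq> {..<N}" by (auto simp: not_le[symmetric])
  then show ?thesis by (rule finite_subset) simp
qed

lemma twisted_diff_add: "twisted_diff b h (x + y) = twisted_diff b h x + twisted_diff b h y"
  using b_add[where vs = "[]"] unfolding twisted_diff_def
  by (simp add: Sum_any.distrib finite_twisted_terms)

lemma twisted_diff_zero: "twisted_diff b h 0 = 0"
  using twisted_diff_add[of 0 0] by simp

lemma twisted_diff_uminus: "twisted_diff b h (- x) = - twisted_diff b h x"
  using twisted_diff_add[of x "- x"]
  by (simp add: twisted_diff_zero eq_neg_iff_add_eq_0 add.commute)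

lemma twisted_diff_diff: "twisted_diff b h (x - y) = twisted_diff b h x - twisted_diff b h y"
  using twisted_diff_add[of x "- y"] by (simp add: twisted_diff_uminus)

lemma twisted_diff_in_degree_sum:
  assumes a: "a \<in> degree_sum A I" and J: "\<And>i j. i \<in> I \<Longrightarrow> i + 2 * int j + 1 \<in> J"
  shows "twisted_diff b h a \<in> degree_sum A J"
proof -
  have "b (replicate n h @ [a]) \<in> degree_sum A J" for n
  proof (rule b_in_degree_sum)
    show "list_all2 (\<lambda>I x. x \<in> degree_sum A I)
        (replicate n {k. 0 < k \<and> even k} @ [I]) (replicate n h @ [a])"
      using h_degrees a by (rule word_in_degree_sums)
    fix ks assume "list_all2 (\<in>) ks (replicate n {k. 0 < k \<and> even k} @ [I])"
    then obtain ks' i where ks: "ks = ks' @ [i]" "i \<in> I"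
      and ks': "list_all2 (\<in>) ks' (replicate n {k. 0 < k \<and> even k})"
      by (auto simp: list_all2_append2 list_all2_Cons2)
    have pos: "0 < k \<and> even k" if k: "k \<in> set ks'" for k
      using in_set_list_all2_replicate[OF ks' k] by simp
    have "even (sum_list ks')" "0 \<le> sum_list ks'"
      using pos by (auto intro!: even_sum_list sum_list_nonneg dest: less_imp_le)
    then obtain j where "sum_list ks' = 2 * int j"
      by (metis evenE mult_2 nonneg_int_cases of_nat_add zero_le_mult_iff zero_less_numeral
          not_le order.strict_trans2 mult_le_0_iff)
    then show "sum_list ks + 1 \<in> J" using J[OF ks(2), of j] ks(1) by (simp add: add.commute)
  qed simp
  then show ?thesis
    by (auto simp: twisted_diff_def in_degree_sum_iff component_Sum_any finite_twisted_terms)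
qed

lemma twisted_diff_filt: "a \<in> filt A p \<Longrightarrow> twisted_diff b h a \<in> filt A (p + 1)"
  unfolding filt_def by (rule twisted_diff_in_degree_sum) auto

lemma twisted_diff_parity: "a \<in> parity_part A p \<Longrightarrow> twisted_diff b h a \<in> parity_part A (p + 1)"
  unfolding parity_part_def by (rule twisted_diff_in_degree_sum) (auto, presburger)

text \<open>Summing the relations for the words \<open>h, \<dots>, h, a\<close> of all lengths gives
  \<open>\<partial>\<^sub>h (\<partial>\<^sub>h a)\<close> from the terms whose inner operation contains \<open>a\<close>; the other terms collect to
  operations with an entry \<open>\<partial>\<^sub>h h = 0\<close>. Local finiteness bounds the sums involved.\<close>

lemma twisted_diff_square_zero: "twisted_diff b h (twisted_diff b h a) = 0"
proof -
  let ?inner = "\<lambda>s. b (replicate s h @ [a])"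
  obtain N1 where N1: "\<And>xs. set xs \<subseteq> {h, a} \<Longrightarrow> N1 \<le> length xs \<Longrightarrow> b xs = 0"
    using long_words_vanish[of "{h, a}"] by auto
  \<comment> \<open>Local finiteness is used twice: \<open>N1\<close> bounds the words in \<open>h\<close> and \<open>a\<close>, so their values form a
    finite set, and \<open>N2\<close> bounds the words that also contain such values.\<close>
  define S where "S = {0, h, a} \<union> (\<lambda>s. b (replicate s h)) ` {..<N1} \<union> ?inner ` {..<N1}"
  have "finite S" by (simp add: S_def)
  then obtain N2 where N2: "\<And>xs. set xs \<subseteq> S \<Longrightarrow> N2 \<le> length xs \<Longrightarrow> b xs = 0"
    using long_words_vanish by blast
  define M where "M = max N1 N2"
  have N1_le: "N1 \<le> M" by (simp add: M_def)
  have in_S: "h \<in> S" "a \<in> S" by (auto simp: S_def)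
  have h_word: "b (replicate s h) \<in> S \<and> (N1 \<le> s \<longrightarrow> b (replicate s h) = 0)" for s
  proof (cases "s < N1")
    case False
    then have "b (replicate s h) = 0" by (intro N1) auto
    then show ?thesis by (simp add: S_def)
  qed (auto simp: S_def)
  have a_word: "?inner s \<in> S \<and> (N1 \<le> s \<longrightarrow> ?inner s = 0)" for s
  proof (cases "s < N1")
    case False
    then have "?inner s = 0" by (intro N1) auto
    then show ?thesis by (simp add: S_def)
  qed (auto simp: S_def)
  have outer: "b (replicate r h @ ?inner s # []) = 0" if "M \<le> r" for r s
    by (rule N2) (use that in_S a_word in \<open>auto simp: M_def\<close>)
  have outer': "b (replicate r h @ b (replicate s h) # replicate t h @ [a]) = 0"
    if "M \<le> r + t" for r s t
    by (rule N2) (use that in_S h_word in \<open>auto simp: M_def\<close>)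

  define G where "G = (\<lambda>(r, s, t). relation_term r s (replicate (r + s + t - 1) h @ [a]))"
  have G_last: "G (r, Suc s, 0) = b (replicate r h @ [?inner s])" for r s
    using relation_term_append[of "replicate r h" "replicate s h @ [a]" "[]"]
    by (simp add: G_def replicate_add)
  have G_inner: "G (r, s, Suc t) = b (replicate r h @ b (replicate s h) # replicate t h @ [a])"
    for r s t
    using relation_term_append[of "replicate r h" "replicate s h" "replicate t h @ [a]"]
    by (simp add: G_def replicate_add)

  let ?T = "\<lambda>n. {(r, s, t). 1 \<le> s \<and> r + s + t = Suc n}"
  let ?K = "3 * Suc M"
  let ?box = "{..<Suc M} \<times> {1..Suc M} \<times> {..<Suc M}"
  have finite_T: "finite (?T n)" for n
    by (rule finite_subset[of _ "{..Suc n} \<times> {..Suc n} \<times> {..Suc n}"]) auto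
  have "(\<Sum>(r, s, t)\<in>?T n. relation_term r s (replicate n h @ [a])) = 0" for n
  proof (rule A_infinity_relation_even)
    have "h \<in> degree_sum A {k. even k}" by (rule degree_sum_mono[OF h_degrees]) auto
    then show "list_all2 (\<lambda>I x. x \<in> degree_sum A I) (replicate n {k. even k} @ [UNIV])
        (replicate n h @ [a])"
      by (rule word_in_degree_sums) (rule degree_sum_UNIV)
  qed
  moreover have "(\<Sum>(r, s, t)\<in>?T n. relation_term r s (replicate n h @ [a])) = sum G (?T n)" for n
    by (rule sum.cong) (auto simp: G_def)
  ultimately have "(\<Sum>n<?K. sum G (?T n)) = 0" by simp
  then have "sum G (\<Union>n<?K. ?T n) = 0"
    by (subst sum.UNION_disjoint) (use finite_T in auto)
  \<comment> \<open>All non-zero terms lie in the box, where the three block lengths vary independently.\<close>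
  also have "sum G (\<Union>n<?K. ?T n) = sum G ?box"
  proof (rule sum.mono_neutral_right)
    show "finite (\<Union>n<?K. ?T n)" using finite_T by blast
    show "?box \<subseteq> (\<Union>n<?K. ?T n)"
    proof
      fix u assume "u \<in> ?box"
      then obtain r s t where u: "u = (r, s, t)" "r \<le> M" "1 \<le> s" "s \<le> Suc M" "t \<le> M" by auto
      then have "u \<in> ?T (r + s + t - 1)" "r + s + t - 1 < ?K" by auto
      then show "u \<in> (\<Union>n<?K. ?T n)" by blast
    qed
    show "\<forall>u\<in>(\<Union>n<?K. ?T n) - ?box. G u = 0"
    proof
      fix u assume u_mem: "u \<in> (\<Union>n<?K. ?T n) - ?box"
      obtain r s t where u1: "u = (r, s, t)" by (cases u)
      then have "1 \<le> s" "\<not> (r \<le> M \<and> s \<le> Suc M \<and> t \<le> M)" using u_mem by auto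
      then have u: "u = (r, s, t)" "1 \<le> s" "M < r \<or> Suc M < s \<or> M < t" using u1 by auto
      show "G u = 0"
      proof (cases t)
        case 0
        obtain s' where s: "s = Suc s'" using u(2) by (cases s) auto
        show ?thesis
        proof (cases "M < r")
          case True
          then show ?thesis using outer[of r s'] by (simp add: u(1) 0 s G_last)
        next
          case False
          then have "N1 \<le> s'" using u(3) 0 s N1_le by linarith
          then have "?inner s' = 0" using a_word[of s'] by simp
          then show ?thesis using b_zero[of "replicate r h" "[]"] by (simp add: u(1) 0 s G_last)
        qed
      next
        case (Suc t')
        show ?thesis
        proof (cases "Suc M < s")
          case True
          then have "b (replicate s h) = 0" using h_word[of s] by (simp add: M_def)
          then show ?thesis by (simp add: u(1) Suc G_inner b_zero)
        next
          case False
          then show ?thesis using u(3) outer'[of r t' s] by (auto simp: u(1) Suc G_inner)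
        qed
      qed
    qed
  qed
  also have "sum G ?box = (\<Sum>r<Suc M. \<Sum>s=1..Suc M. \<Sum>t<Suc M. G (r, s, t))"
    by (simp only: sum.cartesian_product[symmetric] split_def prod.collapse
        sum.cartesian_product')
  also have "\<dots> = (\<Sum>r<Suc M. \<Sum>s<Suc M. \<Sum>t<Suc M. G (r, Suc s, t))"
    by (simp only: One_nat_def sum.atLeast1_atMost_eq)
  also have "\<dots> = (\<Sum>r<Suc M. \<Sum>s<Suc M. b (replicate r h @ [?inner s])
      + (\<Sum>t<M. b (replicate r h @ b (replicate (Suc s) h) # replicate t h @ [a])))"
    by (simp only: sum.lessThan_Suc_shift[where n = M and g = "\<lambda>t. G (_, _, t)"] G_last G_inner)
  also have "\<dots> = (\<Sum>r<Suc M. b (replicate r h @ [twisted_diff b h a]))"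
  proof (rule sum.cong[OF refl])
    fix r
    have support: "Sum_any (\<lambda>s. b (replicate s h @ [c])) = (\<Sum>s<Suc M. b (replicate s h @ [c]))"
      if "set [c] \<subseteq> {h, a}" for c
    proof (rule Sum_any.expand_superset)
      have "b (replicate s h @ [c]) = 0" if "Suc M \<le> s" for s
        by (rule N1) (use that \<open>set [c] \<subseteq> {h, a}\<close> in \<open>auto simp: M_def\<close>)
      then show "{s. b (replicate s h @ [c]) \<noteq> 0} \<subseteq> {..<Suc M}"
        by (metis (mono_tags, lifting) lessThan_iff mem_Collect_eq not_le subsetI)
    qed simp
    have "(\<Sum>s<Suc M. \<Sum>t<M. b (replicate r h @ b (replicate (Suc s) h) # replicate t h @ [a]))
        = (\<Sum>t<M. b (replicate r h @ (\<Sum>s<Suc M. b (replicate (Suc s) h)) # replicate t h @ [a]))"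
      by (subst sum.swap) (simp only: b_sum)
    also have "(\<Sum>s<Suc M. b (replicate (Suc s) h)) = twisted_diff b h h"
      using support[of h] by (simp add: twisted_diff_def replicate_append_same)
    finally have "(\<Sum>s<Suc M. \<Sum>t<M.
        b (replicate r h @ b (replicate (Suc s) h) # replicate t h @ [a])) = 0"
      by (simp add: twisted_diff_h b_zero)
    moreover have "(\<Sum>s<Suc M. b (replicate r h @ [?inner s]))
        = b (replicate r h @ [twisted_diff b h a])"
      using support[of a] b_sum[of "replicate r h" ?inner "{..<Suc M}" "[]"]
      by (simp add: twisted_diff_def)
    ultimately show "(\<Sum>s<Suc M. b (replicate r h @ [?inner s])
        + (\<Sum>t<M. b (replicate r h @ b (replicate (Suc s) h) # replicate t h @ [a])))
      = b (replicate r h @ [twisted_diff b h a])"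
      by (simp only: sum.distrib add_0_right)
  qed
  also have "\<dots> = twisted_diff b h (twisted_diff b h a)"
    unfolding twisted_diff_def[of b h "twisted_diff b h a"]
  proof (rule Sum_any.expand_superset[symmetric])
    have "b (replicate r h @ [twisted_diff b h a]) = 0" if "Suc M \<le> r" for r
    proof -
      have "b (replicate r h @ [twisted_diff b h a])
        = (\<Sum>s | ?inner s \<noteq> 0. b (replicate r h @ [?inner s]))"
        using b_sum[of "replicate r h" ?inner "{s. ?inner s \<noteq> 0}" "[]"]
        by (simp add: twisted_diff_def Sum_any.expand_set)
      also have "\<dots> = 0" using outer that by simp
      finally show ?thesis .
    qed
    then show "{r. b (replicate r h @ [twisted_diff b h a]) \<noteq> 0} \<subseteq> {..<Suc M}"
      by (metis (mono_tags, lifting) lessThan_iff mem_Collect_eq not_le subsetI)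
  qed simp
  finally show ?thesis by simp
qed

end


section \<open>Toeplitz columns as components of the twisted differential\<close>

lemma sum_lists_Suc:
  fixes f :: "nat list \<Rightarrow> 'a::comm_monoid_add"
  shows "(\<Sum>js | length js = Suc n \<and> set js \<subseteq> {..<m}. f js)
    = (\<Sum>j<m. \<Sum>js | length js = n \<and> set js \<subseteq> {..<m}. f (j # js))"
proof -
  let ?L = "\<lambda>n. {js. length js = n \<and> set js \<subseteq> {..<m}}"
  have image: "?L (Suc n) = (\<lambda>(j, js). j # js) ` ({..<m} \<times> ?L n)"
    by (auto simp: length_Suc_conv image_iff)
  have "inj_on (\<lambda>(j, js). j # js) ({..<m} \<times> ?L n)" by (auto intro!: inj_onI)
  then show ?thesis
    unfolding image by (simp add: sum.reindex sum.cartesian_product split_def)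
qed

context twisted_A_infinity_algebra
begin

text \<open>A path \<open>i < j\<^sub>1 < \<dots> < j\<^sub>n\<close> of matrix indices records how many degrees each factor \<open>h\<close> of the
  word \<open>h, \<dots>, h, a\<close> contributes, namely \<open>2 (j\<^sub>1 - i)\<close>, \<open>2 (j\<^sub>2 - j\<^sub>1)\<close> and so on, and the column
  entry at \<open>j\<^sub>n\<close> has just the degree needed to reach the prescribed total. The homogeneous prefix
  \<open>us\<close> is there for the induction, in which the factors \<open>h\<close> are split from left to right.\<close>

lemma component_word_eq_path_sum:
  assumes a: "a \<in> filt A p"
  shows "list_all2 (\<lambda>k x. x \<in> A k) ks us \<Longrightarrow> i < m \<Longrightarrow>
    component A (sum_list ks + (p + 2 * (int m - 1 - int i)) + 1) (b (us @ replicate n h @ [a]))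
    = (\<Sum>js | length js = n \<and> set js \<subseteq> {..<m}.
        b (us @ path_word (twisting_toeplitz A m h) (component_vec A m p a) i js))"
proof (induction n arbitrary: us ks i)
  case 0
  have "{js. length js = 0 \<and> set js \<subseteq> {..<m}} = {[]}" by auto
  then show ?case
    using component_b_last[OF 0(1), of "p + 2 * (int m - 1 - int i)" a] 0(2)
    by (simp add: component_vec_def)
next
  case (Suc n)
  let ?T = "twisting_toeplitz A m h" and ?c = "component_vec A m p a"
  let ?w = "replicate n h @ [a]"
  let ?q = "sum_list ks + (p + 2 * (int m - 1 - int i)) + 1"
  let ?L = "{js. length js = n \<and> set js \<subseteq> {..<m}}"
  have T: "?T $$ (i, j) = (if i < j then component A (2 * (int j - int i)) h else 0)"
    if "j < m" for j
    using that Suc.prems(2) by (simp add: twisting_toeplitz_def)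
  \<comment> \<open>The matrix entries in row \<open>i\<close> are the components of \<open>h\<close> of degree below \<open>2 (m - i)\<close>; a factor of
    larger degree overshoots the total degree.\<close>
  define rest where "rest = h - (\<Sum>j<m. ?T $$ (i, j))"
  have rest: "rest \<in> degree_sum A {2 * (int m - int i)..}"
  proof -
    have "component A k rest = 0" if k: "k < 2 * (int m - int i)" for k
    proof -
      have T_comp: "component A k (?T $$ (i, j))
          = (if k = 2 * (int j - int i) \<and> i < j then component A k h else 0)" if "j < m" for j
        using that by (simp add: T component_homogeneous[OF component_in_degree])
      have "(\<Sum>j<m. component A k (?T $$ (i, j))) = component A k h"
      proof (cases "0 < k \<and> even k")
        case True
        then obtain d where d: "k = 2 * d" "0 < d" by (auto elim!: evenE)
        define j0 where "j0 = i + nat d"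
        have j0: "j0 < m" "k = 2 * (int j0 - int i)" "i < j0"
          using k d by (auto simp: j0_def)
        have "(\<Sum>j<m. component A k (?T $$ (i, j)))
            = (\<Sum>j<m. if j = j0 then component A k h else 0)"
          by (rule sum.cong) (use j0 T_comp in auto)
        then show ?thesis using j0(1) by simp
      next
        case False
        then have "component A k h = 0" using h_degrees by (simp add: in_degree_sum_iff)
        then show ?thesis by (auto simp: T_comp intro!: sum.neutral)
      qed
      then show ?thesis by (simp add: rest_def component_diff component_sum)
    qed
    then show ?thesis by (simp add: in_degree_sum_iff)
  qed
  have "b (us @ rest # ?w) \<in> degree_sum A {sum_list ks + 2 * (int m - int i) + p + 1..}"
  proof (rule b_in_degree_sum)
    show "list_all2 (\<lambda>I x. x \<in> degree_sum A I)
        (map (\<lambda>k. {k}) ks @ {2 * (int m - int i)..} # replicate n {k. 0 < k \<and> even k} @ [{p..}])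
        (us @ rest # ?w)"
      using singletons_in_degree_sums[OF Suc.prems(1)] rest
        word_in_degree_sums[OF h_degrees, of a "{p..}" n] a
      by (auto intro!: list_all2_appendI simp: filt_def)
    fix ds
    assume "list_all2 (\<in>) ds
      (map (\<lambda>k. {k}) ks @ {2 * (int m - int i)..} # replicate n {k. 0 < k \<and> even k} @ [{p..}])"
    then obtain d es e where ds: "ds = ks @ d # es @ [e]" and bounds: "2 * (int m - int i) \<le> d" "p \<le> e"
      and es: "list_all2 (\<in>) es (replicate n {k. 0 < k \<and> even k})"
      by (auto simp: list_all2_append2 list_all2_Cons2 list_all2_map2 list_all2_eq[symmetric])
    have "0 \<le> sum_list es"
      using in_set_list_all2_replicate[OF es] by (intro sum_list_nonneg) force
    then show "sum_list ds + 1 \<in> {sum_list ks + 2 * (int m - int i) + p + 1..}"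
      using bounds ds by simp
  qed simp
  then have rest0: "component A ?q (b (us @ rest # ?w)) = 0" by (simp add: in_degree_sum_iff)
  have step: "component A ?q (b (us @ ?T $$ (i, j) # ?w))
      = (\<Sum>js\<in>?L. b (us @ path_word ?T ?c i (j # js)))" if j: "j < m" for j
  proof (cases "i < j")
    case True
    have "list_all2 (\<lambda>k x. x \<in> A k) (ks @ [2 * (int j - int i)]) (us @ [?T $$ (i, j)])"
      using Suc.prems(1) True j component_in_degree by (auto intro!: list_all2_appendI simp: T)
    from Suc.IH[OF this j] show ?thesis by (simp add: algebra_simps)
  next
    case False
    then show ?thesis using T[OF j] by (simp add: b_zero)
  qed
  have "b (us @ h # ?w) = b (us @ (\<Sum>j<m. ?T $$ (i, j)) # ?w) + b (us @ rest # ?w)"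
    using b_add[of us "\<Sum>j<m. ?T $$ (i, j)" rest ?w] by (simp add: rest_def)
  then have "component A ?q (b (us @ replicate (Suc n) h @ [a]))
      = (\<Sum>j<m. \<Sum>js\<in>?L. b (us @ path_word ?T ?c i (j # js)))"
    using rest0 step by (simp add: component_add b_sum component_sum)
  then show ?case by (simp only: sum_lists_Suc)
qed

text \<open>The bridge between the matrix equations and the spectral sequence: the entries of
  \<open>\<partial>\<^bsub>\<^bold>h\<^esub> \<^bold>a\<close> are the lowest homogeneous components of \<open>\<partial>\<^sub>h a\<close>.\<close>

lemma twisted_vec_toeplitz:
  assumes "a \<in> filt A p" "i < m"
  shows "twisted_vec b (twisting_toeplitz A m h) (component_vec A m p a) $ i
    = component A (p + 2 * (int m - 1 - int i) + 1) (twisted_diff b h a)"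
  using component_word_eq_path_sum[OF assms(1) list_all2_Nil[THEN iffD2] assms(2)] assms(2)
  by (simp add: twisted_vec_def twisting_toeplitz_def twisted_diff_def component_Sum_any
      finite_twisted_terms)

end


section \<open>Bordered Toeplitz matrices and Massey products\<close>

lemma bordered_mat_dims [simp]:
  "dim_row (bordered_mat T c) = Suc (dim_row T)" "dim_col (bordered_mat T c) = Suc (dim_col T)"
  by (simp_all add: bordered_mat_def)

lemma bordered_mat_index:
  assumes "T \<in> carrier_mat m m" "c \<in> carrier_vec m" "i \<le> m" "j \<le> m"
  shows "bordered_mat T c $$ (i, j)
    = (if i = m then 0 else if j = m then c $ i else T $$ (i, j))"
  using assms by (auto simp: bordered_mat_def mat_of_cols_def)

lemma twisting_toeplitz_carrier: "twisting_toeplitz A m h \<in> carrier_mat m m"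
  by (simp add: twisting_toeplitz_def)

lemma twisting_toeplitz_dims [simp]:
  "dim_row (twisting_toeplitz A m h) = m" "dim_col (twisting_toeplitz A m h) = m"
  by (simp_all add: twisting_toeplitz_def)

lemma twisting_toeplitz_index:
  "i < m \<Longrightarrow> j < m \<Longrightarrow>
    twisting_toeplitz A m h $$ (i, j) = (if i < j then component A (2 * (int j - int i)) h else 0)"
  by (simp add: twisting_toeplitz_def)

lemma component_vec_carrier: "component_vec A m p x \<in> carrier_vec m"
  by (simp add: component_vec_def)

lemma bordered_toeplitz_Mat_plus:
  assumes "c \<in> carrier_vec m"
  shows "bordered_mat (twisting_toeplitz A m h) c \<in> Mat_plus (Suc m)"
proof -
  have "twisting_toeplitz A m h $$ (i, j) = 0" if "i < m" "j \<le> i" for i j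
    using that by (simp add: twisting_toeplitz_def)
  then show ?thesis
    using bordered_mat_index[OF twisting_toeplitz_carrier assms]
    by (auto simp: Mat_plus_def less_Suc_eq_le)
qed

lemma component_vec_last: "0 < m \<Longrightarrow> component_vec A m p x $ (m - 1) = component A p x"
  by (simp add: component_vec_def of_nat_diff)

context A_infinity_algebra
begin

text \<open>The bottom row of a bordered matrix and the last entry of \<open>v\<close> vanish, so every word whose path
  visits the last index contains a zero.\<close>

lemma twisted_vec_bordered:
  assumes T: "T \<in> carrier_mat m m" "c \<in> carrier_vec m" and v: "v $ m = 0" "\<And>i. i < m \<Longrightarrow> v $ i = u $ i"
    and i: "i \<le> m"
  shows "twisted_vec b (bordered_mat T c) v $ i = (if i = m then 0 else twisted_vec b T u $ i)"
proof -
  let ?B = "bordered_mat T c"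
  have bottom: "0 \<in> set (path_word ?B v m js)" if "set js \<subseteq> {..m}" for js
    using that v(1) by (cases js) (auto simp: bordered_mat_index[OF T])
  have visit: "0 \<in> set (path_word ?B v i js)" if "set js \<subseteq> {..m}" "m \<in> set js" for i js
    using that by (induction js arbitrary: i) (auto simp: bottom)
  have inside: "path_word ?B v i js = path_word T u i js" if "set js \<subseteq> {..<m}" "i < m" for i js
    using that by (induction js arbitrary: i) (auto simp: v(2) bordered_mat_index[OF T])
  have fin: "finite {js. length js = k \<and> set js \<subseteq> {..<Suc m}}" for k
    using finite_lists_length_eq[of "{..<Suc m}" k] by (simp add: conj_commute)
  have "(\<Sum>js | length js = k \<and> set js \<subseteq> {..<Suc m}. b (path_word ?B v i js))
      = (if i = m then 0 else (\<Sum>js | length js = k \<and> set js \<subseteq> {..<m}. b (path_word T u i js)))"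
    for k
  proof (cases "i = m")
    case True
    have "b (path_word ?B v m js) = 0" if "set js \<subseteq> {..<Suc m}" for js
      using that by (intro b_zero_in_list bottom) (auto simp: less_Suc_eq_le)
    then show ?thesis using True by simp
  next
    case False
    then have "i < m" using i by simp
    have "(\<Sum>js | length js = k \<and> set js \<subseteq> {..<Suc m}. b (path_word ?B v i js))
        = (\<Sum>js | length js = k \<and> set js \<subseteq> {..<m}. b (path_word ?B v i js))"
    proof (rule sum.mono_neutral_right[OF fin])
      show "\<forall>js\<in>{js. length js = k \<and> set js \<subseteq> {..<Suc m}} - {js. length js = k \<and> set js \<subseteq> {..<m}}.
          b (path_word ?B v i js) = 0"
      proof
        fix js assume "js \<in> {js. length js = k \<and> set js \<subseteq> {..<Suc m}}
          - {js. length js = k \<and> set js \<subseteq> {..<m}}"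
        then have "set js \<subseteq> {..m}" "m \<in> set js"
          by (auto simp: less_Suc_eq subset_eq)
        then show "b (path_word ?B v i js) = 0" by (intro b_zero_in_list visit)
      qed
    qed auto
    also have "\<dots> = (\<Sum>js | length js = k \<and> set js \<subseteq> {..<m}. b (path_word T u i js))"
      by (rule sum.cong) (use inside \<open>i < m\<close> in auto)
    finally show ?thesis using False by simp
  qed
  then show ?thesis using i T(1) by (simp add: twisted_vec_def)
qed

end

context twisted_A_infinity_algebra
begin

text \<open>Every column of the Toeplitz matrix is again a column of components of \<open>h\<close>, shifted, so
  \<open>\<partial>\<^sub>h h = 0\<close> makes the corresponding entries vanish.\<close>

lemma twisted_mat_bordered:
  assumes c: "c \<in> carrier_vec m" and ij: "i \<le> m" "j \<le> m"
  shows "twisted_mat b (bordered_mat (twisting_toeplitz A m h) c)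
      (bordered_mat (twisting_toeplitz A m h) c) $$ (i, j)
    = (if i < m \<and> j = m then twisted_vec b (twisting_toeplitz A m h) c $ i else 0)"
proof -
  let ?T = "twisting_toeplitz A m h"
  let ?B = "bordered_mat ?T c"
  note T = twisting_toeplitz_carrier[of A m h]
  have dims: "dim_row ?B = Suc m" "dim_col ?B = Suc m" using T by simp_all
  have entry: "twisted_mat b ?B ?B $$ (i, j) = twisted_vec b ?B (col ?B j) $ i"
    using ij by (simp add: twisted_mat_def dims)
  have B: "col ?B j $ i' = (if i' = m then 0 else if j = m then c $ i' else ?T $$ (i', j))"
    if "i' \<le> m" for i'
    using that ij dims by (simp add: bordered_mat_index[OF T c])
  show ?thesis
  proof (cases "j = m")
    case True
    have "twisted_vec b ?B (col ?B j) $ i = (if i = m then 0 else twisted_vec b ?T c $ i)"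
      by (rule twisted_vec_bordered[OF T c]) (use B True ij in auto)
    then show ?thesis using entry True ij by auto
  next
    case False
    \<comment> \<open>This starting degree puts \<open>h\<^bsub>2(j-i')\<^esub>\<close> into row \<open>i'\<close>; in rows \<open>i' \<ge> j\<close> the degree is not
      positive, which accounts for the zeros.\<close>
    let ?q = "2 * int j - 2 * int m + 2"
    have h0: "component A k h = 0" if "k \<le> 0" for k
      using h_degrees that by (simp add: in_degree_sum_iff)
    have "twisted_vec b ?B (col ?B j) $ i
        = (if i = m then 0 else twisted_vec b ?T (component_vec A m ?q h) $ i)"
    proof (rule twisted_vec_bordered[OF T c])
      fix i' assume "i' < m"
      then show "col ?B j $ i' = component_vec A m ?q h $ i'"
        using False ij by (simp add: dims bordered_mat_index[OF T c] component_vec_def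
            twisting_toeplitz_index h0 algebra_simps)
    qed (use B ij in auto)
    moreover have "twisted_vec b ?T (component_vec A m ?q h) $ i = 0" if "i < m"
    proof -
      have "h \<in> filt A ?q"
        using h_degrees ij False unfolding filt_def by (auto elim!: degree_sum_mono)
      then show ?thesis using that by (simp add: twisted_vec_toeplitz twisted_diff_h)
    qed
    ultimately show ?thesis using entry False ij by auto
  qed
qed

lemma twisting_matrix_bordered_iff:
  assumes c: "c \<in> carrier_vec m"
  shows "twisting_matrix b (m + 1) (bordered_mat (twisting_toeplitz A m h) c)
    \<longleftrightarrow> twisted_vec b (twisting_toeplitz A m h) c = 0\<^sub>v m"
proof -
  let ?T = "twisting_toeplitz A m h"
  let ?B = "bordered_mat ?T c"
  have dims: "twisted_mat b ?B ?B \<in> carrier_mat (Suc m) (Suc m)"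
    using twisting_toeplitz_carrier[of A m h] by (auto simp: twisted_mat_def)
  have "twisted_mat b ?B ?B = 0\<^sub>m (Suc m) (Suc m) \<longleftrightarrow>
      (\<forall>i\<le>m. \<forall>j\<le>m. twisted_mat b ?B ?B $$ (i, j) = 0)"
    using dims by (auto simp: mat_eq_iff less_Suc_eq_le)
  also have "\<dots> \<longleftrightarrow> (\<forall>i<m. twisted_vec b ?T c $ i = 0)"
    using c by (auto simp: twisted_mat_bordered)
  also have "\<dots> \<longleftrightarrow> twisted_vec b ?T c = 0\<^sub>v m"
    using twisting_toeplitz_carrier[of A m h] by (auto simp: vec_eq_iff twisted_vec_def)
  finally show ?thesis
    using bordered_toeplitz_Mat_plus[OF c] by (simp add: twisting_matrix_def)
qed

lemma defining_system_bordered_iff: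
  assumes c: "c \<in> carrier_vec m"
  shows "defining_system b m (bordered_mat (twisting_toeplitz A m h) c)
    \<longleftrightarrow> (\<forall>i<m. 0 < i \<longrightarrow> twisted_vec b (twisting_toeplitz A m h) c $ i = 0)"
  using bordered_toeplitz_Mat_plus[OF c] c
  by (auto simp: defining_system_def twisted_mat_bordered)

lemma massey_value_bordered:
  assumes "c \<in> carrier_vec m" "0 < m"
  shows "massey_value b m (bordered_mat (twisting_toeplitz A m h) c)
    = twisted_vec b (twisting_toeplitz A m h) c $ 0"
  using assms by (simp add: massey_value_def twisted_mat_bordered)

lemma twisted_vec_eq_vCons_iff:
  assumes "0 < m"
  shows "twisted_vec b (twisting_toeplitz A m h) c = vCons z (0\<^sub>v (m - 1))
    \<longleftrightarrow> twisted_vec b (twisting_toeplitz A m h) c $ 0 = z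
      \<and> (\<forall>i<m. 0 < i \<longrightarrow> twisted_vec b (twisting_toeplitz A m h) c $ i = 0)"
proof -
  let ?v = "twisted_vec b (twisting_toeplitz A m h) c"
  have "dim_vec ?v = m"
    using twisting_toeplitz_carrier[of A m h] by (simp add: twisted_vec_def)
  then show ?thesis
    using assms by (auto simp: vec_eq_iff vec_index_vCons)
qed

text \<open>This is the case of a single row, where the Toeplitz matrix is zero.\<close>

lemma b_lowest_component:
  assumes "a \<in> filt A p"
  shows "b [component A p a] = component A (p + 1) (twisted_diff b h a)"
proof -
  let ?T = "twisting_toeplitz A 1 h" and ?c = "component_vec A 1 p a"
  have words: "{js. length js = k \<and> set js \<subseteq> {..<Suc 0}} = {replicate k 0}" for k
    by (auto simp: lessThan_Suc intro!: replicate_eqI)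
  have "b (path_word ?T ?c 0 (replicate k 0)) = 0" if "0 < k" for k
    by (rule b_zero_in_list) (use that in \<open>cases k; simp add: twisting_toeplitz_def\<close>)
  then have "twisted_vec b ?T ?c $ 0 = b (path_word ?T ?c 0 (replicate 0 0))"
    by (subst twisted_vec_def)
      (auto simp: twisting_toeplitz_def words intro!: Sum_any.expand_superset[of "{0}", THEN trans])
  then show ?thesis
    using twisted_vec_toeplitz[OF assms, of 0 1] by (simp add: component_vec_def)
qed

lemma h2_closed: "b [component A 2 h] = 0"
proof -
  have "h \<in> filt A 2"
    using h_degrees unfolding filt_def by (auto elim!: degree_sum_mono)
  then show ?thesis by (simp add: b_lowest_component twisted_diff_h)
qed

lemma defining_system_of_bordered:
  assumes m: "2 \<le> m" and c: "c \<in> carrier_vec m" and closed: "b [c $ (m - 1)] = 0"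
    and rows: "\<And>i. i < m \<Longrightarrow> 0 < i \<Longrightarrow> twisted_vec b (twisting_toeplitz A m h) c $ i = 0"
  shows "defining_system_of b
      (replicate (m - 1) (cohomology_class b (component A 2 h)) @ [cohomology_class b (c $ (m - 1))])
      (bordered_mat (twisting_toeplitz A m h) c)"
proof -
  let ?B = "bordered_mat (twisting_toeplitz A m h) c"
  let ?as = "replicate (m - 1) (cohomology_class b (component A 2 h))
    @ [cohomology_class b (c $ (m - 1))]"
  have len: "length ?as = m" using m by simp
  have "set ?as \<subseteq> cohomology b"
    using h2_closed closed by (auto simp: cohomology_def)
  moreover have "?as ! i = cohomology_class b (?B $$ (i, i + 1))" if "i < m" for i
  proof (cases "i = m - 1")
    case True
    then have "\<not> i < m - 1" "i \<noteq> m" "Suc i = m" using m by auto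
    then show ?thesis
      using True by (simp add: nth_append bordered_mat_index[OF twisting_toeplitz_carrier c])
  next
    case False
    then have "i + 1 < m" "i < m - 1" using that by auto
    then show ?thesis
      by (simp add: nth_append bordered_mat_index[OF twisting_toeplitz_carrier c]
          twisting_toeplitz_index)
  qed
  moreover have "defining_system b m ?B"
    using rows by (simp add: defining_system_bordered_iff[OF c])
  ultimately show ?thesis using m len by (simp add: defining_system_of_def)
qed

end


section \<open>The spectral sequence\<close>

context graded_space
begin

lemma filt_add: "x \<in> filt A p \<Longrightarrow> y \<in> filt A p \<Longrightarrow> x + y \<in> filt A p"
  and filt_diff: "x \<in> filt A p \<Longrightarrow> y \<in> filt A p \<Longrightarrow> x - y \<in> filt A p"
  and filt_uminus: "x \<in> filt A p \<Longrightarrow> - x \<in> filt A p"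
  and filt_mono: "x \<in> filt A q \<Longrightarrow> p \<le> q \<Longrightarrow> x \<in> filt A p"
  and parity_add: "x \<in> parity_part A p \<Longrightarrow> y \<in> parity_part A p \<Longrightarrow> x + y \<in> parity_part A p"
  and parity_diff: "x \<in> parity_part A p \<Longrightarrow> y \<in> parity_part A p \<Longrightarrow> x - y \<in> parity_part A p"
  and parity_uminus: "x \<in> parity_part A p \<Longrightarrow> - x \<in> parity_part A p"
  by (simp_all add: in_filt_iff in_parity_part_iff component_add component_diff component_uminus)

lemma parity_part_cong: "even (p - q) \<Longrightarrow> parity_part A p = parity_part A q"
  unfolding parity_part_def by (metis mod_eq_dvd_iff)

lemma diff_component_in_filt:
  assumes "x \<in> filt A p" shows "x - component A p x \<in> filt A (p + 1)"
proof -
  have "component A k (x - component A p x) = 0" if "k < p + 1" for k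
    using assms that component_homogeneous[OF component_in_degree[of p x], of k]
    by (cases "k = p") (auto simp: in_filt_iff component_diff)
  then show ?thesis by (simp add: in_filt_iff)
qed

lemma diff_in_filt_iff:
  assumes "x \<in> filt A p" "y \<in> A p"
  shows "x - y \<in> filt A (p + 1) \<longleftrightarrow> component A p x = y"
proof
  assume "x - y \<in> filt A (p + 1)"
  then show "component A p x = y"
    using component_homogeneous[OF assms(2), of p] by (simp add: in_filt_iff component_diff)
next
  assume "component A p x = y"
  then show "x - y \<in> filt A (p + 1)" using diff_component_in_filt[OF assms(1)] by simp
qed

text \<open>The column of \<open>a\<close> involves \<open>m\<close> components only, so lifts in the spectral sequence can be
  replaced by elements of the finite form that the matrix equations ask for.\<close>

lemma truncation:
  obtains x where "x \<in> degree_sum A {q + 2 * int i | i. i < m}"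
    "component_vec A m q x = component_vec A m q a"
proof
  let ?D = "{q + 2 * int i | i. i < m}"
  let ?x = "\<Sum>k\<in>?D. component A k a"
  have "?D = (\<lambda>i. q + 2 * int i) ` {..<m}" by auto
  then have "finite ?D" by simp
  then have comp: "component A k ?x = (if k \<in> ?D then component A k a else 0)" for k
    by (rule component_sum_homogeneous) (rule component_in_degree)
  show "?x \<in> degree_sum A ?D"
    unfolding in_degree_sum_iff
  proof (intro allI impI)
    fix k assume "k \<notin> ?D"
    then show "component A k ?x = 0" by (simp only: comp if_False)
  qed
  show "component_vec A m q ?x = component_vec A m q a"
  proof (rule eq_vecI)
    fix i assume "i < dim_vec (component_vec A m q a)"
    then have i: "i < m" by (simp add: component_vec_def)
    then have "q + 2 * (int m - 1 - int i) = q + 2 * int (m - 1 - i)" "m - 1 - i < m" by auto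
    then have "q + 2 * (int m - 1 - int i) \<in> ?D" by blast
    then show "component_vec A m q ?x $ i = component_vec A m q a $ i"
      using i by (simp only: component_vec_def index_vec comp if_True)
  qed (simp add: component_vec_def)
qed

lemma column_degrees:
  assumes "x \<in> degree_sum A {q + 2 * int i | i. i < m}"
  shows "x \<in> filt A q" "x \<in> parity_part A q"
  using assms unfolding filt_def parity_part_def by (auto elim!: degree_sum_mono)

end

context twisted_A_infinity_algebra
begin

lemma twisted_diff_in_filt_iff:
  assumes "a \<in> filt A q" "a \<in> parity_part A q"
  shows "twisted_diff b h a \<in> filt A (q + 2 * int n + 1)
    \<longleftrightarrow> (\<forall>l<n. component A (q + 2 * int l + 1) (twisted_diff b h a) = 0)"
proof
  assume "twisted_diff b h a \<in> filt A (q + 2 * int n + 1)"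
  then show "\<forall>l<n. component A (q + 2 * int l + 1) (twisted_diff b h a) = 0"
    by (simp add: in_filt_iff)
next
  assume low: "\<forall>l<n. component A (q + 2 * int l + 1) (twisted_diff b h a) = 0"
  have "component A k (twisted_diff b h a) = 0" if k: "k < q + 2 * int n + 1" for k
  proof (cases "k < q + 1 \<or> odd (k - (q + 1))")
    case True
    then show ?thesis
    proof
      assume "k < q + 1"
      then show ?thesis using twisted_diff_filt[OF assms(1)] by (simp add: in_filt_iff)
    next
      assume "odd (k - (q + 1))"
      then have "k mod 2 \<noteq> (q + 1) mod 2" by (metis mod_eq_dvd_iff)
      then show ?thesis using twisted_diff_parity[OF assms(2)] by (simp add: in_parity_part_iff)
    qed
  next
    case False
    then have "even (k - (q + 1))" by blast
    then obtain l where l: "k - (q + 1) = 2 * l" by (rule evenE)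
    then have "k = q + 2 * int (nat l) + 1" "nat l < n" using False k by auto
    then show ?thesis using low by blast
  qed
  then show "twisted_diff b h a \<in> filt A (q + 2 * int n + 1)" by (simp add: in_filt_iff)
qed

text \<open>The \<open>n\<close> bottom rows are the components of \<open>\<partial>\<^sub>h a\<close> in degrees \<open>q + 1, q + 3, \<dots>, q + 2 n - 1\<close>,
  the only ones below \<open>q + 2 n + 1\<close> that degree and parity leave open. Only \<open>n = m\<close> and \<open>n = m - 1\<close>
  occur below: the first gives cycles, the second gives boundaries and Massey values.\<close>

lemma bottom_rows_vanish_iff:
  assumes "a \<in> filt A q" "a \<in> parity_part A q" "n \<le> m"
  shows "(\<forall>i<m. m - n \<le> i \<longrightarrow>
      twisted_vec b (twisting_toeplitz A m h) (component_vec A m q a) $ i = 0)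
    \<longleftrightarrow> twisted_diff b h a \<in> filt A (q + 2 * int n + 1)"
proof -
  let ?v = "twisted_vec b (twisting_toeplitz A m h) (component_vec A m q a)"
  have row: "?v $ (m - 1 - l) = component A (q + 2 * int l + 1) (twisted_diff b h a)"
    if "l < n" for l
    using twisted_vec_toeplitz[OF assms(1), of "m - 1 - l" m] that assms(3)
    by (simp add: algebra_simps of_nat_diff)
  have "(\<forall>i<m. m - n \<le> i \<longrightarrow> ?v $ i = 0) \<longleftrightarrow> (\<forall>l<n. ?v $ (m - 1 - l) = 0)"
  proof
    assume *: "\<forall>l<n. ?v $ (m - 1 - l) = 0"
    show "\<forall>i<m. m - n \<le> i \<longrightarrow> ?v $ i = 0"
    proof (intro allI impI)
      fix i assume "i < m" "m - n \<le> i"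
      then have "m - 1 - i < n" "m - 1 - (m - 1 - i) = i" using assms(3) by auto
      then show "?v $ i = 0" using * by metis
    qed
  qed (use assms(3) in auto)
  then show ?thesis using row by (simp add: twisted_diff_in_filt_iff[OF assms(1,2)])
qed

lemma twisted_vec_eq_zero_iff:
  assumes "a \<in> filt A q" "a \<in> parity_part A q"
  shows "twisted_vec b (twisting_toeplitz A m h) (component_vec A m q a) = 0\<^sub>v m
    \<longleftrightarrow> twisted_diff b h a \<in> filt A (q + 2 * int m + 1)"
  using bottom_rows_vanish_iff[OF assms, of m m]
  by (auto simp: vec_eq_iff twisted_vec_def[of b "twisting_toeplitz A m h"])

lemma twisted_vec_eq_vCons_iff_filt:
  assumes "a \<in> filt A q" "a \<in> parity_part A q" "0 < m"
  shows "twisted_vec b (twisting_toeplitz A m h) (component_vec A m q a) = vCons z (0\<^sub>v (m - 1))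
    \<longleftrightarrow> twisted_diff b h a \<in> filt A (q + 2 * int m - 1)
      \<and> component A (q + 2 * int m - 1) (twisted_diff b h a) = z"
proof -
  have "q + 2 * int (m - 1) + 1 = q + 2 * int m - 1" using assms(3) by (simp add: of_nat_diff)
  moreover have "m - (m - 1) \<le> i \<longleftrightarrow> 0 < i" for i using assms(3) by auto
  ultimately show ?thesis
    using bottom_rows_vanish_iff[OF assms(1,2), of "m - 1" m]
      twisted_vec_toeplitz[OF assms(1) assms(3)] twisted_vec_eq_vCons_iff[OF assms(3)]
    by (auto simp: algebra_simps)
qed

lemma ss_B_zero: "0 \<in> ss_B A b h r p"
  using zero_degree unfolding ss_B_def
  by (auto simp: twisted_diff_zero in_filt_iff in_parity_part_iff intro!: bexI[of _ 0])

lemma ss_B_add: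
  assumes "x \<in> ss_B A b h r p" "y \<in> ss_B A b h r p" shows "x + y \<in> ss_B A b h r p"
proof -
  obtain u v where
    u: "u \<in> filt A (p - int r + 1) \<inter> parity_part A (p - 1)" "twisted_diff b h u \<in> filt A p"
      "twisted_diff b h u - x \<in> filt A (p + 1)" and
    v: "v \<in> filt A (p - int r + 1) \<inter> parity_part A (p - 1)" "twisted_diff b h v \<in> filt A p"
      "twisted_diff b h v - y \<in> filt A (p + 1)"
    using assms by (auto simp: ss_B_def)
  have split: "twisted_diff b h (u + v) - (x + y)
      = (twisted_diff b h u - x) + (twisted_diff b h v - y)"
    by (simp add: twisted_diff_add)
  have "twisted_diff b h (u + v) - (x + y) \<in> filt A (p + 1)"
    unfolding split by (rule filt_add[OF u(3) v(3)])
  moreover have "twisted_diff b h (u + v) \<in> filt A p"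
    using u v by (simp add: twisted_diff_add filt_add)
  moreover have "u + v \<in> filt A (p - int r + 1) \<inter> parity_part A (p - 1)"
    using u v by (simp add: filt_add parity_add)
  moreover have "x + y \<in> A p" using assms by (simp add: ss_B_def add_degree)
  ultimately show ?thesis unfolding ss_B_def by blast
qed

lemma ss_B_uminus:
  assumes "x \<in> ss_B A b h r p" shows "- x \<in> ss_B A b h r p"
proof -
  obtain u where
    u: "u \<in> filt A (p - int r + 1) \<inter> parity_part A (p - 1)" "twisted_diff b h u \<in> filt A p"
      "twisted_diff b h u - x \<in> filt A (p + 1)"
    using assms by (auto simp: ss_B_def)
  have "twisted_diff b h (- u) - (- x) = - (twisted_diff b h u - x)"
    by (simp add: twisted_diff_uminus)
  then have "twisted_diff b h (- u) - (- x) \<in> filt A (p + 1)" using u by (simp only: filt_uminus)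
  moreover have "twisted_diff b h (- u) \<in> filt A p"
    using u by (simp add: twisted_diff_uminus filt_uminus)
  moreover have "- u \<in> filt A (p - int r + 1) \<inter> parity_part A (p - 1)"
    using u by (simp add: filt_uminus parity_uminus)
  moreover have "- x \<in> A p" using assms by (simp add: ss_B_def uminus_degree)
  ultimately show ?thesis unfolding ss_B_def by blast
qed

lemma ss_class_eq_iff: "ss_class A b h r p x = ss_class A b h r p y \<longleftrightarrow> x - y \<in> ss_B A b h r p"
proof
  assume "ss_class A b h r p x = ss_class A b h r p y"
  moreover have "x \<in> ss_class A b h r p x"
    using ss_B_zero by (force simp: ss_class_def elt_set_plus_def)
  ultimately show "x - y \<in> ss_B A b h r p"
    by (auto simp: ss_class_def elt_set_plus_def)
next
  have sub: "ss_class A b h r p x \<subseteq> ss_class A b h r p y" if "x - y \<in> ss_B A b h r p" for x y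
  proof
    fix z assume "z \<in> ss_class A b h r p x"
    then obtain w where w: "w \<in> ss_B A b h r p" "z = x + w"
      by (auto simp: ss_class_def elt_set_plus_def)
    then have "z = y + ((x - y) + w)" "(x - y) + w \<in> ss_B A b h r p"
      using that by (auto intro: ss_B_add)
    then show "z \<in> ss_class A b h r p y" unfolding ss_class_def elt_set_plus_def by blast
  qed
  assume "x - y \<in> ss_B A b h r p"
  moreover have "y - x \<in> ss_B A b h r p" using ss_B_uminus[OF calculation] by simp
  ultimately show "ss_class A b h r p x = ss_class A b h r p y" using sub by blast
qed

text \<open>If \<open>x - x'\<close> is hit by \<open>\<partial>\<^sub>h yt\<close> to leading order, then \<open>u = xt - xt' - \<partial>\<^sub>h yt\<close> starts one degree
  later, and \<open>\<partial>\<^sub>h u = \<partial>\<^sub>h xt - \<partial>\<^sub>h xt'\<close> because \<open>\<partial>\<^sub>h\<close> squares to zero. So \<open>u\<close> exhibits the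
  difference of the two values as a boundary.\<close>

lemma ss_d_value_well_defined:
  assumes r: "odd r" and lifts: "ss_lift A b h r p x xt" "ss_lift A b h r p x' xt'"
    and bd: "x - x' \<in> ss_B A b h r p"
  shows "component A (p + int r) (twisted_diff b h xt) - component A (p + int r) (twisted_diff b h xt')
    \<in> ss_B A b h r (p + int r)"
proof -
  let ?d = "twisted_diff b h"
  obtain yt where yt: "yt \<in> parity_part A (p - 1)" "?d yt - (x - x') \<in> filt A (p + 1)"
    using bd by (auto simp: ss_B_def)
  define u where "u = xt - xt' - ?d yt"
  have "u = (xt - x) - (xt' - x') - (?d yt - (x - x'))" by (simp add: u_def)
  moreover have "xt - x \<in> filt A (p + 1)" "xt' - x' \<in> filt A (p + 1)"
    using lifts by (simp_all add: ss_lift_def)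
  ultimately have "u \<in> filt A (p + int r - int r + 1)"
    using yt(2) by (simp only: filt_diff add_diff_cancel_right')
  moreover have "u \<in> parity_part A (p + int r - 1)"
  proof -
    have "?d yt \<in> parity_part A p" using twisted_diff_parity[OF yt(1)] by simp
    then have "u \<in> parity_part A p"
      using lifts unfolding u_def by (intro parity_diff) (simp_all add: ss_lift_def)
    moreover have "parity_part A (p + int r - 1) = parity_part A p"
      by (rule parity_part_cong) (use r in simp)
    ultimately show ?thesis by simp
  qed
  moreover have du: "?d u = ?d xt - ?d xt'"
    by (simp add: u_def twisted_diff_diff twisted_diff_square_zero)
  moreover have "?d u \<in> filt A (p + int r)"
    unfolding du using lifts by (intro filt_diff) (simp_all add: ss_lift_def)
  moreover have "?d u - component A (p + int r) (?d u) \<in> filt A (p + int r + 1)"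
    by (rule diff_component_in_filt) fact
  ultimately have "component A (p + int r) (?d u) \<in> ss_B A b h r (p + int r)"
    using component_in_degree unfolding ss_B_def by blast
  then show ?thesis by (simp add: du component_diff)
qed

lemma ss_d_eq:
  assumes r: "odd r" and x: "x \<in> A p" and lift: "ss_lift A b h r p x xt"
  shows "ss_d A b h r p (ss_class A b h r p x)
    = ss_class A b h r (p + int r) (component A (p + int r) (twisted_diff b h xt))"
  unfolding ss_d_def
proof (rule the_equality)
  show "\<exists>y\<in>ss_Z A b h r p. \<exists>yt. ss_class A b h r p x = ss_class A b h r p y \<and>
      ss_lift A b h r p y yt \<and>
      ss_class A b h r (p + int r) (component A (p + int r) (twisted_diff b h xt))
        = ss_class A b h r (p + int r) (component A (p + int r) (twisted_diff b h yt))"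
    using x lift by (auto simp: ss_Z_def)
next
  fix D assume "\<exists>y\<in>ss_Z A b h r p. \<exists>yt. ss_class A b h r p x = ss_class A b h r p y \<and>
      ss_lift A b h r p y yt \<and>
      D = ss_class A b h r (p + int r) (component A (p + int r) (twisted_diff b h yt))"
  then obtain y yt where y: "y - x \<in> ss_B A b h r p" "ss_lift A b h r p y yt"
      "D = ss_class A b h r (p + int r) (component A (p + int r) (twisted_diff b h yt))"
    using ss_class_eq_iff by metis
  show "D = ss_class A b h r (p + int r) (component A (p + int r) (twisted_diff b h xt))"
    unfolding y(3) ss_class_eq_iff by (rule ss_d_value_well_defined[OF r y(2) lift y(1)])
qed

text \<open>The element \<open>\<partial>\<^sub>h xt\<close> is closed, so it lifts its own leading component.\<close>

lemma ss_d_value_in_Z: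
  assumes r: "odd r" and lift: "ss_lift A b h r p x xt"
  shows "component A (p + int r) (twisted_diff b h xt) \<in> ss_Z A b h r (p + int r)"
proof -
  let ?dx = "twisted_diff b h xt"
  have "?dx \<in> filt A (p + int r)" using lift by (simp add: ss_lift_def)
  moreover have "?dx \<in> parity_part A (p + int r)"
  proof -
    have "?dx \<in> parity_part A (p + 1)"
      using lift by (intro twisted_diff_parity) (simp add: ss_lift_def)
    moreover have "parity_part A (p + int r) = parity_part A (p + 1)"
      by (rule parity_part_cong) (use r in simp)
    ultimately show ?thesis by simp
  qed
  moreover have "twisted_diff b h ?dx \<in> filt A (p + int r + int r)"
    by (simp add: twisted_diff_square_zero in_filt_iff)
  ultimately have "ss_lift A b h r (p + int r) (component A (p + int r) ?dx) ?dx"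
    by (simp add: ss_lift_def diff_component_in_filt)
  then show ?thesis using component_in_degree by (auto simp: ss_Z_def)
qed

end


section \<open>Cycles, boundaries and differentials as matrix equations\<close>

context twisted_A_infinity_algebra
begin

text \<open>Together with truncation, this is the description of cycles by the matrix equation; it is also
  what makes every solution of the equation usable for computing the differential.\<close>

lemma ss_lift_iff:
  assumes "x \<in> filt A p" "x \<in> parity_part A p" "x\<^sub>p \<in> A p"
  shows "ss_lift A b h (2 * m + 1) p x\<^sub>p x \<longleftrightarrow>
    component A p x = x\<^sub>p \<and>
    twisted_vec b (twisting_toeplitz A m h) (component_vec A m p x) = 0\<^sub>v m"
  using assms diff_in_filt_iff[OF assms(1,3)] twisted_vec_eq_zero_iff[OF assms(1,2), of m]
  by (simp add: ss_lift_def algebra_simps)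

lemma ss_Z_iff_twisted_vec:
  assumes "0 < m" "x\<^sub>p \<in> A p"
  shows "x\<^sub>p \<in> ss_Z A b h (2 * m + 1) p \<longleftrightarrow>
    (\<exists>x. x \<in> degree_sum A {p + 2 * int i | i. i < m} \<and> component A p x = x\<^sub>p \<and>
      twisted_vec b (twisting_toeplitz A m h) (component_vec A m p x) = 0\<^sub>v m)"
proof
  assume "x\<^sub>p \<in> ss_Z A b h (2 * m + 1) p"
  then obtain xt where xt: "ss_lift A b h (2 * m + 1) p x\<^sub>p xt" by (auto simp: ss_Z_def)
  then have "xt \<in> filt A p" "xt \<in> parity_part A p" by (auto simp: ss_lift_def)
  note * = ss_lift_iff[OF this assms(2), of m]
  obtain x where x: "x \<in> degree_sum A {p + 2 * int i | i. i < m}"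
    "component_vec A m p x = component_vec A m p xt"
    by (rule truncation[of p m xt])
  have "component A p x = x\<^sub>p"
    "twisted_vec b (twisting_toeplitz A m h) (component_vec A m p x) = 0\<^sub>v m"
    using * xt component_vec_last[OF assms(1), of A p] by (metis x(2))+
  with x(1) show "\<exists>x. x \<in> degree_sum A {p + 2 * int i | i. i < m} \<and> component A p x = x\<^sub>p \<and>
      twisted_vec b (twisting_toeplitz A m h) (component_vec A m p x) = 0\<^sub>v m"
    by blast
next
  assume "\<exists>x. x \<in> degree_sum A {p + 2 * int i | i. i < m} \<and> component A p x = x\<^sub>p \<and>
      twisted_vec b (twisting_toeplitz A m h) (component_vec A m p x) = 0\<^sub>v m"
  then obtain x where x: "x \<in> degree_sum A {p + 2 * int i | i. i < m}" "component A p x = x\<^sub>p"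
    "twisted_vec b (twisting_toeplitz A m h) (component_vec A m p x) = 0\<^sub>v m"
    by blast
  then have "ss_lift A b h (2 * m + 1) p x\<^sub>p x"
    using ss_lift_iff[OF column_degrees[OF x(1)] assms(2)] by blast
  then show "x\<^sub>p \<in> ss_Z A b h (2 * m + 1) p" using assms(2) by (auto simp: ss_Z_def)
qed

lemma ss_B_iff_twisted_vec:
  assumes m: "0 < m" and x: "x\<^sub>p \<in> A p"
  shows "x\<^sub>p \<in> ss_B A b h (2 * m + 1) p \<longleftrightarrow>
    (\<exists>y. y \<in> degree_sum A {(p - 2 * int m + 1) + 2 * int i | i. i < m} \<and>
      twisted_vec b (twisting_toeplitz A m h) (component_vec A m (p - 2 * int m + 1) y)
        = vCons x\<^sub>p (0\<^sub>v (m - 1)))"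
proof -
  let ?q = "p - 2 * int m + 1"
  let ?eq = "\<lambda>y. twisted_vec b (twisting_toeplitz A m h) (component_vec A m ?q y)
    = vCons x\<^sub>p (0\<^sub>v (m - 1))"
  have parity: "parity_part A (p - 1) = parity_part A ?q" by (rule parity_part_cong) simp
  have eq_iff: "?eq y \<longleftrightarrow> twisted_diff b h y \<in> filt A p
      \<and> twisted_diff b h y - x\<^sub>p \<in> filt A (p + 1)"
    if "y \<in> filt A ?q" "y \<in> parity_part A ?q" for y
    using twisted_vec_eq_vCons_iff_filt[OF that m, of x\<^sub>p] diff_in_filt_iff[OF _ x, of "twisted_diff b h y"]
    by auto
  show ?thesis
  proof
    assume "x\<^sub>p \<in> ss_B A b h (2 * m + 1) p"
    then obtain yt where yt: "yt \<in> filt A (p - 2 * int m)" "yt \<in> parity_part A (p - 1)"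
      "twisted_diff b h yt \<in> filt A p" "twisted_diff b h yt - x\<^sub>p \<in> filt A (p + 1)"
      by (auto simp: ss_B_def algebra_simps)
    \<comment> \<open>The component in degree \<open>p - 2 m\<close> has the wrong parity.\<close>
    have "yt \<in> filt A ?q"
    proof -
      have "component A k yt = 0" if "k < ?q" for k
      proof (cases "k = p - 2 * int m")
        case True
        then have "k mod 2 \<noteq> (p - 1) mod 2" by presburger
        then show ?thesis using yt(2) by (simp add: in_parity_part_iff)
      next
        case False
        then show ?thesis using yt(1) that by (simp add: in_filt_iff)
      qed
      then show ?thesis by (simp add: in_filt_iff)
    qed
    then have "?eq yt" using yt eq_iff parity by simp
    obtain y where y: "y \<in> degree_sum A {?q + 2 * int i | i. i < m}"
      "component_vec A m ?q y = component_vec A m ?q yt"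
      by (rule truncation[of ?q m yt])
    from \<open>?eq yt\<close> have "?eq y" by (simp only: y(2))
    with y(1) show "\<exists>y. y \<in> degree_sum A {?q + 2 * int i | i. i < m} \<and> ?eq y" by blast
  next
    assume "\<exists>y. y \<in> degree_sum A {?q + 2 * int i | i. i < m} \<and> ?eq y"
    then obtain y where y: "y \<in> degree_sum A {?q + 2 * int i | i. i < m}" "?eq y" by blast
    note deg = column_degrees[OF y(1)]
    have "y \<in> filt A (p - int (2 * m + 1) + 1)" by (rule filt_mono[OF deg(1)]) simp
    then show "x\<^sub>p \<in> ss_B A b h (2 * m + 1) p"
      using x deg(2) parity y(2) eq_iff[OF deg] by (auto simp: ss_B_def)
  qed
qed

lemma bordered_system_iff:
  assumes "0 < m" "c \<in> carrier_vec m"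
  shows "twisted_vec b (twisting_toeplitz A m h) c = vCons z (0\<^sub>v (m - 1)) \<longleftrightarrow>
    defining_system b m (bordered_mat (twisting_toeplitz A m h) c) \<and>
    z = massey_value b m (bordered_mat (twisting_toeplitz A m h) c)"
  unfolding twisted_vec_eq_vCons_iff[OF assms(1)] defining_system_bordered_iff[OF assms(2)]
    massey_value_bordered[OF assms(2,1)]
  by blast

text \<open>The bottom row of the matrix equation says that the bottom entry of the column is closed.\<close>

lemma bordered_system_defines_massey_product:
  assumes m: "2 \<le> m" and a: "a \<in> filt A q"
    and eq: "twisted_vec b (twisting_toeplitz A m h) (component_vec A m q a) = vCons z (0\<^sub>v (m - 1))"
  shows "defining_system_of b
      (replicate (m - 1) (cohomology_class b (component A 2 h)) @
        [cohomology_class b (component A q a)])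
      (bordered_mat (twisting_toeplitz A m h) (component_vec A m q a))" (is "defining_system_of b ?as ?B")
    and "cohomology_class b z \<in> massey_product b
      (replicate (m - 1) (cohomology_class b (component A 2 h)) @
        [cohomology_class b (component A q a)])"
proof -
  let ?c = "component_vec A m q a"
  let ?v = "twisted_vec b (twisting_toeplitz A m h) ?c"
  have m0: "0 < m" using m by simp
  have rows: "?v $ i = 0" if "i < m" "0 < i" for i
    using eq that unfolding twisted_vec_eq_vCons_iff[OF m0] by blast
  have bottom: "?c $ (m - 1) = component A q a"
    by (rule component_vec_last[OF m0])
  have "b [component A q a] = ?v $ (m - 1)"
    using twisted_vec_toeplitz[OF a, of "m - 1" m] m
    by (simp add: b_lowest_component[OF a] of_nat_diff)
  then have closed: "b [?c $ (m - 1)] = 0" using rows[of "m - 1"] m bottom by simp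
  show sys: "defining_system_of b ?as ?B"
    using defining_system_of_bordered[OF m component_vec_carrier closed rows] by (simp only: bottom)
  have "z = massey_value b (length ?as) ?B"
    using eq bordered_system_iff[OF m0 component_vec_carrier] m by auto
  then show "cohomology_class b z \<in> massey_product b ?as"
    using sys unfolding massey_product_def by blast
qed

lemma zero_in_massey_product:
  assumes m: "2 \<le> m" and x: "x\<^sub>p \<in> ss_Z A b h (2 * m + 1) p"
  shows "cohomology_class b 0 \<in> massey_product b
    (replicate (m - 1) (cohomology_class b (component A 2 h)) @ [cohomology_class b x\<^sub>p])"
proof -
  have m0: "0 < m" and "x\<^sub>p \<in> A p" using m x by (auto simp: ss_Z_def)
  then obtain a where a: "a \<in> degree_sum A {p + 2 * int i | i. i < m}" "component A p a = x\<^sub>p"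
    "twisted_vec b (twisting_toeplitz A m h) (component_vec A m p a) = 0\<^sub>v m"
    using x ss_Z_iff_twisted_vec[of m x\<^sub>p p] by blast
  have "(0\<^sub>v m :: 'a vec) = vCons 0 (0\<^sub>v (m - 1))"
    using m0 by (auto simp: vec_eq_iff vec_index_vCons)
  then show ?thesis
    using bordered_system_defines_massey_product(2)[OF m column_degrees(1)[OF a(1)], of 0] a(2,3)
    by simp
qed

text \<open>Whatever \<open>w\<close> is, its degree is so high that \<open>x + w\<close> is again a lift of \<open>x\<^sub>p\<close>. The only row of
  the larger system that can be non-zero is the top one, and it is the leading component of
  \<open>\<partial>\<^sub>h (x + w)\<close>, whose class is the value of the differential.\<close>

lemma ss_d_as_massey_value:
  assumes m: "0 < m" and xp: "x\<^sub>p \<in> A p"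
    and x: "x \<in> degree_sum A {p + 2 * int i | i. i < m}" "component A p x = x\<^sub>p"
      "twisted_vec b (twisting_toeplitz A m h) (component_vec A m p x) = 0\<^sub>v m"
    and w: "w \<in> A (p + 2 * int m)"
  obtains z where "z \<in> A (p + 2 * int m + 1)"
    "twisted_vec b (twisting_toeplitz A (m + 1) h) (component_vec A (m + 1) p (x + w))
      = vCons z (0\<^sub>v m)"
    "defining_system b (m + 1)
      (bordered_mat (twisting_toeplitz A (m + 1) h) (component_vec A (m + 1) p (x + w)))"
    "defining_system_of b
      (replicate m (cohomology_class b (component A 2 h)) @ [cohomology_class b x\<^sub>p])
      (bordered_mat (twisting_toeplitz A (m + 1) h) (component_vec A (m + 1) p (x + w)))"
    "z = massey_value b (m + 1)
      (bordered_mat (twisting_toeplitz A (m + 1) h) (component_vec A (m + 1) p (x + w)))"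
    "z \<in> ss_Z A b h (2 * m + 1) (p + 2 * int m + 1)"
    "ss_d A b h (2 * m + 1) p (ss_class A b h (2 * m + 1) p x\<^sub>p)
      = ss_class A b h (2 * m + 1) (p + 2 * int m + 1) z"
proof -
  let ?d = "twisted_diff b h"
  let ?a = "x + w"
  define z where "z = component A (p + 2 * int m + 1) (?d ?a)"
  have lift_x: "ss_lift A b h (2 * m + 1) p x\<^sub>p x"
    using ss_lift_iff[OF column_degrees[OF x(1)] xp] x by blast
  have w_filt: "w \<in> filt A (p + 2 * int m)"
    using component_homogeneous[OF w] by (simp add: in_filt_iff)
  have w_parity: "w \<in> parity_part A p"
    using component_homogeneous[OF w] by (auto simp: in_parity_part_iff)
  have r: "p + int (2 * m + 1) = p + 2 * int m + 1" by simp
  have "ss_lift A b h (2 * m + 1) p x\<^sub>p ?a"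
  proof -
    have "w \<in> filt A p" "w \<in> filt A (p + 1)" using filt_mono[OF w_filt] m by simp_all
    moreover have "?a - x\<^sub>p \<in> filt A (p + 1)"
    proof -
      have "(x - x\<^sub>p) + w \<in> filt A (p + 1)"
        by (rule filt_add) (use lift_x calculation in \<open>simp_all add: ss_lift_def\<close>)
      then show ?thesis by (simp add: algebra_simps)
    qed
    moreover have "?d w \<in> filt A (p + 2 * int m + 1)" by (rule twisted_diff_filt[OF w_filt])
    ultimately show ?thesis
      using lift_x w_parity unfolding ss_lift_def r twisted_diff_add
      by (auto intro: filt_add parity_add)
  qed
  note lift = this
  then have a: "?a \<in> filt A p" "?a \<in> parity_part A p" and da: "?d ?a \<in> filt A (p + 2 * int m + 1)"
    unfolding ss_lift_def r by simp_all
  have comp_a: "component A p ?a = x\<^sub>p"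
    using x(2) component_homogeneous[OF w] m by (simp add: component_add)
  have eq: "twisted_vec b (twisting_toeplitz A (m + 1) h) (component_vec A (m + 1) p ?a)
      = vCons z (0\<^sub>v (m + 1 - 1))"
    using twisted_vec_eq_vCons_iff_filt[OF a, of "m + 1" z] da by (simp add: z_def algebra_simps)
  have m1: "0 < m + 1" by simp
  show thesis
  proof (rule that[of z])
    show "z \<in> A (p + 2 * int m + 1)" unfolding z_def by (rule component_in_degree)
    show "twisted_vec b (twisting_toeplitz A (m + 1) h) (component_vec A (m + 1) p ?a)
        = vCons z (0\<^sub>v m)" using eq by simp
    show "defining_system b (m + 1)
        (bordered_mat (twisting_toeplitz A (m + 1) h) (component_vec A (m + 1) p ?a))"
      "z = massey_value b (m + 1)
        (bordered_mat (twisting_toeplitz A (m + 1) h) (component_vec A (m + 1) p ?a))"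
      using eq bordered_system_iff[OF m1 component_vec_carrier] by blast+
    show "defining_system_of b
        (replicate m (cohomology_class b (component A 2 h)) @ [cohomology_class b x\<^sub>p])
        (bordered_mat (twisting_toeplitz A (m + 1) h) (component_vec A (m + 1) p ?a))"
      using bordered_system_defines_massey_product(1)[OF _ a(1) eq] m comp_a by simp
    show "z \<in> ss_Z A b h (2 * m + 1) (p + 2 * int m + 1)"
      using ss_d_value_in_Z[OF _ lift] unfolding r z_def by simp
    show "ss_d A b h (2 * m + 1) p (ss_class A b h (2 * m + 1) p x\<^sub>p)
        = ss_class A b h (2 * m + 1) (p + 2 * int m + 1) z"
      using ss_d_eq[OF _ xp lift] unfolding r z_def by simp
  qed
qed

end


theorem theorem5p4:
  fixes scale :: "'k::field \<Rightarrow> 'a::ab_group_add \<Rightarrow> 'a"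
    and A :: "int \<Rightarrow> 'a set"
    and b :: "'a list \<Rightarrow> 'a"
    and h x\<^sub>p :: 'a
    and m :: nat
    and p :: int
  assumes "A_infinity_algebra scale A b"
    and "locally_finite_ops b"
    and "positive_twisting_element A b h"
    and "1 \<le> m"
    and "x\<^sub>p \<in> A p"
  shows
    "((x\<^sub>p \<in> ss_Z A b h (2 * m + 1) p \<longleftrightarrow>
        (\<exists>x. x \<in> degree_sum A {p + 2 * int i | i. i < m} \<and> component A p x = x\<^sub>p \<and>
          twisted_vec b (twisting_toeplitz A m h) (component_vec A m p x) = 0\<^sub>v m))
      \<and> (\<forall>x. x \<in> degree_sum A {p + 2 * int i | i. i < m} \<and> component A p x = x\<^sub>p \<longrightarrow>
          (twisted_vec b (twisting_toeplitz A m h) (component_vec A m p x) = 0\<^sub>v m \<longleftrightarrow>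
            twisting_matrix b (m + 1)
              (bordered_mat (twisting_toeplitz A m h) (component_vec A m p x))))
      \<and> (x\<^sub>p \<in> ss_Z A b h (2 * m + 1) p \<and> 2 \<le> m \<longrightarrow>
          cohomology_class b 0 \<in> massey_product b
            (replicate (m - 1) (cohomology_class b (component A 2 h)) @ [cohomology_class b x\<^sub>p])))
    \<and>
    ((x\<^sub>p \<in> ss_B A b h (2 * m + 1) p \<longleftrightarrow>
        (\<exists>y. y \<in> degree_sum A {p - 2 * int i + 1 | i. 1 \<le> i \<and> i \<le> m} \<and>
          twisted_vec b (twisting_toeplitz A m h) (component_vec A m (p - 2 * int m + 1) y)
            = vCons x\<^sub>p (0\<^sub>v (m - 1))))
      \<and> (\<forall>y. y \<in> degree_sum A {p - 2 * int i + 1 | i. 1 \<le> i \<and> i \<le> m} \<longrightarrow>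
          (twisted_vec b (twisting_toeplitz A m h) (component_vec A m (p - 2 * int m + 1) y)
              = vCons x\<^sub>p (0\<^sub>v (m - 1)) \<longleftrightarrow>
            defining_system b m
              (bordered_mat (twisting_toeplitz A m h) (component_vec A m (p - 2 * int m + 1) y)) \<and>
            x\<^sub>p = massey_value b m
              (bordered_mat (twisting_toeplitz A m h) (component_vec A m (p - 2 * int m + 1) y)))
          \<and> (twisted_vec b (twisting_toeplitz A m h) (component_vec A m (p - 2 * int m + 1) y)
              = vCons x\<^sub>p (0\<^sub>v (m - 1)) \<and> 2 \<le> m \<longrightarrow>
            defining_system_of b
              (replicate (m - 1) (cohomology_class b (component A 2 h)) @
                [cohomology_class b (component A (p - 2 * int m + 1) y)])
              (bordered_mat (twisting_toeplitz A m h) (component_vec A m (p - 2 * int m + 1) y)) \<and>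
            cohomology_class b x\<^sub>p \<in> massey_product b
              (replicate (m - 1) (cohomology_class b (component A 2 h)) @
                [cohomology_class b (component A (p - 2 * int m + 1) y)]))))
    \<and>
    (x\<^sub>p \<in> ss_Z A b h (2 * m + 1) p \<longrightarrow>
      (\<forall>x w. x \<in> degree_sum A {p + 2 * int i | i. i < m} \<and> component A p x = x\<^sub>p \<and>
          twisted_vec b (twisting_toeplitz A m h) (component_vec A m p x) = 0\<^sub>v m \<and>
          w \<in> A (p + 2 * int m) \<longrightarrow>
        (\<exists>z \<in> A (p + 2 * int m + 1).
          twisted_vec b (twisting_toeplitz A (m + 1) h) (component_vec A (m + 1) p (x + w))
            = vCons z (0\<^sub>v m) \<and>
          defining_system b (m + 1)
            (bordered_mat (twisting_toeplitz A (m + 1) h) (component_vec A (m + 1) p (x + w))) \<and>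
          defining_system_of b
            (replicate m (cohomology_class b (component A 2 h)) @ [cohomology_class b x\<^sub>p])
            (bordered_mat (twisting_toeplitz A (m + 1) h) (component_vec A (m + 1) p (x + w))) \<and>
          z = massey_value b (m + 1)
            (bordered_mat (twisting_toeplitz A (m + 1) h) (component_vec A (m + 1) p (x + w))) \<and>
          z \<in> ss_Z A b h (2 * m + 1) (p + 2 * int m + 1) \<and>
          ss_d A b h (2 * m + 1) p (ss_class A b h (2 * m + 1) p x\<^sub>p)
            = ss_class A b h (2 * m + 1) (p + 2 * int m + 1) z)))"
proof -
  interpret twisted_A_infinity_algebra scale A b h
    using assms(1-3)
    by (simp add: twisted_A_infinity_algebra_def twisted_A_infinity_algebra_axioms_def)
  have m: "0 < m" using assms(4) by simp
  let ?q = "p - 2 * int m + 1"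
  have degrees: "{p - 2 * int i + 1 | i. 1 \<le> i \<and> i \<le> m} = {?q + 2 * int i | i. i < m}"
    (is "?L = ?R")
  proof
    show "?L \<subseteq> ?R"
    proof
      fix k assume "k \<in> ?L"
      then obtain i where "k = p - 2 * int i + 1" "1 \<le> i" "i \<le> m" by blast
      then have "k = ?q + 2 * int (m - i)" "m - i < m" by (auto simp: of_nat_diff)
      then show "k \<in> ?R" by blast
    qed
    show "?R \<subseteq> ?L"
    proof
      fix k assume "k \<in> ?R"
      then obtain i where "k = ?q + 2 * int i" "i < m" by blast
      then have "k = p - 2 * int (m - i) + 1" "1 \<le> m - i" "m - i \<le> m" by (auto simp: of_nat_diff)
      then show "k \<in> ?L" by blast
    qed
  qed
  show ?thesis
    unfolding degrees
  proof (intro conjI allI impI)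
    show "x\<^sub>p \<in> ss_Z A b h (2 * m + 1) p \<longleftrightarrow>
      (\<exists>x. x \<in> degree_sum A {p + 2 * int i | i. i < m} \<and> component A p x = x\<^sub>p \<and>
        twisted_vec b (twisting_toeplitz A m h) (component_vec A m p x) = 0\<^sub>v m)"
      by (rule ss_Z_iff_twisted_vec[OF m assms(5)])
    show "twisted_vec b (twisting_toeplitz A m h) (component_vec A m p x) = 0\<^sub>v m \<longleftrightarrow>
      twisting_matrix b (m + 1) (bordered_mat (twisting_toeplitz A m h) (component_vec A m p x))" for x
      by (simp only: twisting_matrix_bordered_iff[OF component_vec_carrier])
    show "cohomology_class b 0 \<in> massey_product b
      (replicate (m - 1) (cohomology_class b (component A 2 h)) @ [cohomology_class b x\<^sub>p])"
      if "x\<^sub>p \<in> ss_Z A b h (2 * m + 1) p \<and> 2 \<le> m"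
      using that zero_in_massey_product by blast
    show "x\<^sub>p \<in> ss_B A b h (2 * m + 1) p \<longleftrightarrow>
      (\<exists>y. y \<in> degree_sum A {?q + 2 * int i | i. i < m} \<and>
        twisted_vec b (twisting_toeplitz A m h) (component_vec A m ?q y) = vCons x\<^sub>p (0\<^sub>v (m - 1)))"
      by (rule ss_B_iff_twisted_vec[OF m assms(5)])
    show "twisted_vec b (twisting_toeplitz A m h) (component_vec A m ?q y) = vCons x\<^sub>p (0\<^sub>v (m - 1)) \<longleftrightarrow>
      defining_system b m (bordered_mat (twisting_toeplitz A m h) (component_vec A m ?q y)) \<and>
      x\<^sub>p = massey_value b m (bordered_mat (twisting_toeplitz A m h) (component_vec A m ?q y))" for y
      by (rule bordered_system_iff[OF m component_vec_carrier])
  next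
    fix y
    assume "y \<in> degree_sum A {?q + 2 * int i | i. i < m}"
      and "twisted_vec b (twisting_toeplitz A m h) (component_vec A m ?q y) = vCons x\<^sub>p (0\<^sub>v (m - 1))
        \<and> 2 \<le> m"
    then show "defining_system_of b
        (replicate (m - 1) (cohomology_class b (component A 2 h)) @
          [cohomology_class b (component A ?q y)])
        (bordered_mat (twisting_toeplitz A m h) (component_vec A m ?q y))"
      "cohomology_class b x\<^sub>p \<in> massey_product b
        (replicate (m - 1) (cohomology_class b (component A 2 h)) @
          [cohomology_class b (component A ?q y)])"
      using bordered_system_defines_massey_product[OF _ column_degrees(1)] by blast+
  next
    fix x w
    assume x: "x \<in> degree_sum A {p + 2 * int i | i. i < m} \<and> component A p x = x\<^sub>p \<and>
      twisted_vec b (twisting_toeplitz A m h) (component_vec A m p x) = 0\<^sub>v m \<and>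
      w \<in> A (p + 2 * int m)"
    show "\<exists>z \<in> A (p + 2 * int m + 1).
      twisted_vec b (twisting_toeplitz A (m + 1) h) (component_vec A (m + 1) p (x + w))
        = vCons z (0\<^sub>v m) \<and>
      defining_system b (m + 1)
        (bordered_mat (twisting_toeplitz A (m + 1) h) (component_vec A (m + 1) p (x + w))) \<and>
      defining_system_of b
        (replicate m (cohomology_class b (component A 2 h)) @ [cohomology_class b x\<^sub>p])
        (bordered_mat (twisting_toeplitz A (m + 1) h) (component_vec A (m + 1) p (x + w))) \<and>
      z = massey_value b (m + 1)
        (bordered_mat (twisting_toeplitz A (m + 1) h) (component_vec A (m + 1) p (x + w))) \<and>
      z \<in> ss_Z A b h (2 * m + 1) (p + 2 * int m + 1) \<and>
      ss_d A b h (2 * m + 1) p (ss_class A b h (2 * m + 1) p x\<^sub>p)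
        = ss_class A b h (2 * m + 1) (p + 2 * int m + 1) z"
      by (rule ss_d_as_massey_value[of m x\<^sub>p p x w]) (use m assms(5) x in blast)+
  qed
qed

end
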